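(* Let $\mathcal{K}$ be a finite-dimensional real Hilbert space, let $\mathcal{M}_1,\mathcal{M}_2\subset\mathcal{K}$ be closed sets, and let $A\in\mathcal{M}_1\cap\mathcal{M}_2$ be a non-tangential point (with smoothness class $C^2$). Let $\epsilon>0$ and $c$ with $1>c>\sigma(A)$ be given. Then there exists $s>0$ such that for every $B\in\mathcal{K}$ with $\|B-A\|<s$ the sequence of alternating projections $$B_0=\pi_1(B),\quad B_1=\pi_2(\pi_1(B)),\quad B_2=\pi_1(\pi_2(\pi_1(B))),\quad B_3=\pi_2(\pi_1(\pi_2(\pi_1(B)))),\ \ldots$$ satisfies: (i) $(B_k)_{k\ge 0}$ converges to a point $B_\infty\in\mathcal{M}_1\cap\mathcal{M}_2$; (ii) $\|B_\infty-\pi(B)\|<\epsilon\,\|B-\pi(B)\|$; (iii) $\|B_\infty-B_k\|<c^k\,\|B-\pi(B)\|$ for all $k\ge 0$.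
   Context: Local manifolds: a set $\mathcal{M}\subset\mathcal{K}$ is locally an $m$-dimensional $C^p$-manifold around (at) $A\in\mathcal{M}$ if there are $r_1>0$ and a $C^p$-map $\phi:\{x\in\mathbb{R}^m:\|x\|<r_1\}\to\mathcal{K}$ such that $d\phi(x)$ is injective for all $x$, $\phi(0)=A$, and $\phi$ is a homeomorphism onto an open neighborhood of $A$ in $\mathcal{M}$ (with the topology induced from $\mathcal{K}$). For $B=\phi(x)$ the tangent space is the linear subspace $T_{\mathcal{M}}(B)=\mathrm{Ran}\, d\phi(x)$. Regular point (class $C^p$, $p\ge 1$): a point $A\in\mathcal{M}_1\cap\mathcal{M}_2$ such that, for some numbers $m_1,m_2,m$, each $\mathcal{M}_j$ is locally an $m_j$-dimensional $C^p$-manifold at $A$ ($j=1,2$), and $\mathcal{M}_1\cap\mathcal{M}_2$ is locally an $m$-dimensional $C^p$-manifold at $A$. Here $p=2$. For a regular point $A$ put $$\sigma(A)=\lim_{r\to0}\sup\left\{\frac{\langle B_1-A,B_2-A\rangle}{\|B_1-A\|\,\|B_2-A\|}: B_j\in\mathcal{M}_j,\ \|B_j-A\|<r,\ B_j-A\perp T_{\mathcal{M}_1\cap\mathcal{M}_2}(A),\ j=1,2\right\};$$ the angle of $\mathcal{M}_1$ and $\mathcal{M}_2$ at $A$ is $\cos^{-1}\sigma(A)$. The point $A$ is non-tangential if it is regular and $\sigma(A)<1$, i.e. if the angle at $A$ is positive. Projections: $\pi_1(B),\pi_2(B),\pi(B)$ denote the unique closest point to $B$ in $\mathcal{M}_1$,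 $\mathcal{M}_2$ and $\mathcal{M}_1\cap\mathcal{M}_2$, respectively. These are well defined for all points sufficiently near $A$, and $s$ is understood to be small enough that all projections occurring are well defined.
   Formalization: For B in M1∩M2 the strict bounds (ii),(iii) read 0<0; instead B_∞=B_k=B is proved. For k=0, (iii) fails for B in M1\M2 (B_0=B, so ‖B_∞−B‖≥‖B−π(B)‖); there the bound has factor 1+ε. For B outside M1∩M2, (ii) and (iii) with k≥1 are as stated. *)

theory Defs
  imports "HOL-Analysis.Analysis"
begin

text \<open>
  Parameter domains are open balls \<open>U\<close> in a linear subspace \<open>V\<close>; a subspace with \<open>dim V = m\<close> plays
  the role of \<open>\<real>\<^sup>m\<close>. Derivatives are taken within \<open>U\<close>, hence are determined by the function on
  vectors of \<open>V\<close>, and only there. In finite dimension the \<open>C\<^sup>p\<close> property can be tested on the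
  directional derivatives \<open>x \<mapsto> df(x) v\<close> with \<open>v \<in> V\<close>.
\<close>

fun Cp_on :: "nat \<Rightarrow> 'a::euclidean_space set \<Rightarrow> 'a set \<Rightarrow> ('a \<Rightarrow> 'b::real_normed_vector) \<Rightarrow> bool" where
  "Cp_on 0 V U f \<longleftrightarrow> continuous_on U f"
| "Cp_on (Suc p) V U f \<longleftrightarrow>
     (\<forall>x\<in>U. f differentiable (at x within U)) \<and>
     (\<forall>v\<in>V. Cp_on p V U (\<lambda>x. frechet_derivative f (at x within U) v))"

text \<open>
  Since \<open>d\<phi>(x)\<close> is injective, the dimension \<open>m\<close> never exceeds that of the ambient space, so there is
  no loss in taking \<open>V\<close> to be a subspace of the ambient space itself.
\<close>

definition local_param ::
  "nat \<Rightarrow> nat \<Rightarrow> 'a::euclidean_space set \<Rightarrow> 'a \<Rightarrow> 'a set \<Rightarrow> real \<Rightarrow> ('a \<Rightarrow> 'a) \<Rightarrow> bool" where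
  "local_param p m M A V r \<phi> \<longleftrightarrow>
     subspace V \<and> dim V = m \<and> r > 0 \<and> \<phi> 0 = A \<and>
     (let U = V \<inter> ball 0 r in
        Cp_on p V U \<phi> \<and>
        (\<forall>x\<in>U. inj_on (frechet_derivative \<phi> (at x within U)) V) \<and>
        openin (top_of_set M) (\<phi> ` U) \<and>
        (\<exists>\<psi>. homeomorphism U (\<phi> ` U) \<phi> \<psi>))"

definition locally_manifold :: "nat \<Rightarrow> nat \<Rightarrow> 'a::euclidean_space set \<Rightarrow> 'a \<Rightarrow> bool" where
  "locally_manifold p m M A \<longleftrightarrow> A \<in> M \<and> (\<exists>V r \<phi>. local_param p m M A V r \<phi>)"

text \<open>The range of \<open>d\<phi>(0)\<close> does not depend on the parametrization \<open>\<phi>\<close> with \<open>\<phi>(0) = A\<close>.\<close>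

definition tangent_space :: "nat \<Rightarrow> 'a::euclidean_space set \<Rightarrow> 'a \<Rightarrow> 'a set" where
  "tangent_space p M A =
     (SOME T. \<exists>m V r \<phi>. local_param p m M A V r \<phi> \<and>
        T = frechet_derivative \<phi> (at 0 within V \<inter> ball 0 r) ` V)"

definition regular_point :: "nat \<Rightarrow> 'a::euclidean_space set \<Rightarrow> 'a set \<Rightarrow> 'a \<Rightarrow> bool" where
  "regular_point p M1 M2 A \<longleftrightarrow> A \<in> M1 \<inter> M2 \<and>
     (\<exists>m1 m2 m. locally_manifold p m1 M1 A \<and> locally_manifold p m2 M2 A \<and>
        locally_manifold p m (M1 \<inter> M2) A)"

text \<open>
  For \<open>B1 = A\<close> or \<open>B2 = A\<close> the quotient is \<open>0 / 0 = 0\<close>. This does not affect the limit when both sets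
  contain admissible points other than \<open>A\<close> arbitrarily near \<open>A\<close>, since each set of admissible
  directions is then symmetric in the limit and the supremum is asymptotically nonnegative anyway.
  Otherwise (one of the sets is locally contained in the other) it fixes the supremum to be \<open>0\<close>,
  i.e. the angle to be \<open>\<pi>/2\<close>.
\<close>

definition sigma_at :: "nat \<Rightarrow> 'a::euclidean_space set \<Rightarrow> 'a set \<Rightarrow> 'a \<Rightarrow> real" where
  "sigma_at p M1 M2 A =
     Lim (at_right 0) (\<lambda>r. Sup {((B1 - A) \<bullet> (B2 - A)) / (norm (B1 - A) * norm (B2 - A)) | B1 B2.
        B1 \<in> M1 \<and> norm (B1 - A) < r \<and> (\<forall>t\<in>tangent_space p (M1 \<inter> M2) A. orthogonal (B1 - A) t) \<and>
        B2 \<in> M2 \<and> norm (B2 - A) < r \<and> (\<forall>t\<in>tangent_space p (M1 \<inter> M2) A. orthogonal (B2 - A) t)})"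

definition nontangential :: "nat \<Rightarrow> 'a::euclidean_space set \<Rightarrow> 'a set \<Rightarrow> 'a \<Rightarrow> bool" where
  "nontangential p M1 M2 A \<longleftrightarrow> regular_point p M1 M2 A \<and> sigma_at p M1 M2 A < 1"

text \<open>Where this holds, \<^const>\<open>closest_point\<close> is the projection.\<close>

definition proj_defined :: "'a::euclidean_space set \<Rightarrow> 'a \<Rightarrow> bool" where
  "proj_defined S B \<longleftrightarrow> (\<exists>!P. P \<in> S \<and> (\<forall>Q\<in>S. dist B P \<le> dist B Q))"

fun alt_proj :: "'a::euclidean_space set \<Rightarrow> 'a set \<Rightarrow> 'a \<Rightarrow> nat \<Rightarrow> 'a" where
  "alt_proj M1 M2 B 0 = closest_point M1 B"
| "alt_proj M1 M2 B (Suc k) = closest_point (if even k then M2 else M1) (alt_proj M1 M2 B k)"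

end

theory Submission
  imports Defs
begin

text \<open>
  The second-order hypothesis enters only through charts with Lipschitz derivative. For a closed set
  \<open>M\<close> with such a chart at \<open>A\<close>, tangent space \<open>T\<close> and orthogonal projector \<open>P\<close> onto \<open>T\<close>, secants of
  \<open>M\<close> near \<open>A\<close> are almost in \<open>T\<close>, and residuals \<open>B - \<pi>\<^sub>M(B)\<close> are almost orthogonal to \<open>T\<close>.
  Hence \<open>\<pi>\<^sub>M(B)\<close> equals \<open>p + P (B - p)\<close> up to \<open>e * norm (B - p)\<close>, for every \<open>p \<in> M\<close> near \<open>A\<close> and with
  the fixed projector \<open>P\<close>.

  Let \<open>\<pi>\<close> be the projection onto \<open>M1 \<inter> M2\<close>, and let \<open>T \<subseteq> T1 \<inter> T2\<close> be the tangent spaces at \<open>A\<close>. The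
  angle hypothesis gives \<open>u1 \<bullet> u2 \<le> c2 * (norm u1 * norm u2)\<close> for \<open>u1 \<in> T1\<close>, \<open>u2 \<in> T2\<close> orthogonal to \<open>T\<close>.
  If \<open>X \<in> M1\<close> and \<open>Y = \<pi>\<^sub>2(X)\<close>, then \<open>X - \<pi>(X)\<close> is almost in \<open>T1\<close> and almost orthogonal to \<open>T\<close>. So the
  distance to \<open>\<pi>\<close> shrinks by a factor \<open>c3 < c\<close> in every step, while \<open>\<pi>(Y)\<close> differs from \<open>\<pi>(X)\<close> by at most
  a small multiple of \<open>norm (X - \<pi>(X))\<close>; the points \<open>\<pi>(B\<^sub>k)\<close> then converge geometrically.
\<close>

section \<open>Orthogonal projectors\<close>

locale orth_projector =
  fixes T :: "'a::euclidean_space set" and P :: "'a \<Rightarrow> 'a"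
  assumes subspace_T: "subspace T"
    and linear_P: "linear P"
    and P_in: "P x \<in> T"
    and residual_orth: "t \<in> T \<Longrightarrow> (x - P x) \<bullet> t = 0"
begin

lemma P_diff: "P (x - y) = P x - P y"
  by (simp add: linear_P linear_diff)

lemma P_add: "P (x + y) = P x + P y"
  by (simp add: linear_P linear_add)

lemma P_zero: "P 0 = 0"
  by (simp add: linear_P linear_0)

text \<open>The vector \<open>P x - y\<close> lies in \<open>T\<close> and is orthogonal to all of
  \<open>T\<close>, itself included, hence vanishes.\<close>

lemma P_eqI:
  assumes "y \<in> T" "\<And>t. t \<in> T \<Longrightarrow> (x - y) \<bullet> t = 0"
  shows "P x = y"
proof -
  have "P x - y \<in> T"
    using subspace_T P_in assms(1) by (simp add: subspace_diff)
  then have "(x - y) \<bullet> (P x - y) - (x - P x) \<bullet> (P x - y) = 0"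
    using assms(2) residual_orth by simp
  then have "(P x - y) \<bullet> (P x - y) = 0"
    by (simp add: inner_diff_left inner_diff_right)
  then show ?thesis by simp
qed

lemma P_fixed: "x \<in> T \<Longrightarrow> P x = x"
  by (rule P_eqI) auto

lemma P_idem: "P (P x) = P x"
  by (simp add: P_fixed P_in)

lemma P_inner: "t \<in> T \<Longrightarrow> P x \<bullet> t = x \<bullet> t"
  using residual_orth[of t x] by (simp add: inner_diff_left)

lemma pythagoras: "(norm x)\<^sup>2 = (norm (P x))\<^sup>2 + (norm (x - P x))\<^sup>2"
proof -
  have "x \<bullet> P x = P x \<bullet> P x"
    using P_inner[OF P_in] by simp
  then show ?thesis
    by (simp add: power2_norm_eq_inner inner_diff_left inner_diff_right inner_commute)
qed

lemma norm_P_le: "norm (P x) \<le> norm x"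
  using pythagoras[of x] by (simp add: power2_le_imp_le)

lemma norm_residual_le: "norm (x - P x) \<le> norm x"
  using pythagoras[of x] by (simp add: power2_le_imp_le)

text \<open>Test with \<open>t = P x\<close>, where \<open>x \<bullet> P x\<close> is the square of
  \<open>norm (P x)\<close>, and cancel one factor.\<close>

lemma norm_P_leI:
  assumes "0 \<le> e" "\<And>t. t \<in> T \<Longrightarrow> \<bar>x \<bullet> t\<bar> \<le> e * norm t"
  shows "norm (P x) \<le> e"
proof -
  have "norm (P x) * norm (P x) = x \<bullet> P x"
    using P_inner[OF P_in, of x x] by (metis norm_eq_sqrt_inner real_sqrt_mult_self abs_of_nonneg inner_ge_zero)
  also have "\<dots> \<le> e * norm (P x)"
    using assms(2)[OF P_in, of x] by linarith
  finally show ?thesis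
    using assms(1) by (auto simp: mult_le_cancel_right)
qed

end

lemma orth_projector_exists:
  fixes T :: "'a::euclidean_space set"
  assumes "subspace T"
  obtains P where "orth_projector T P"
proof -
  obtain B where B: "B \<subseteq> T" "pairwise orthogonal B" "\<And>x. x \<in> B \<Longrightarrow> norm x = 1"
    "independent B" "span B = T"
    using orthonormal_basis_subspace[OF assms] by metis
  have fin: "finite B"
    using B(4) independent_imp_finite by blast
  define P where "P x = (\<Sum>b\<in>B. (x \<bullet> b) *\<^sub>R b)" for x
  have "(x - P x) \<bullet> t = 0" if "t \<in> T" for x t
  proof -
    have "orthogonal (x - P x) b" if "b \<in> B" for b
    proof -
      have "(\<Sum>b'\<in>B. (x \<bullet> b') *\<^sub>R b') \<bullet> b = (\<Sum>b'\<in>B. if b' = b then x \<bullet> b else 0)"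
        unfolding inner_sum_left
        by (rule sum.cong) (use B that in \<open>auto simp: pairwise_def orthogonal_def norm_eq_1\<close>)
      then show ?thesis
        using that fin by (simp add: P_def orthogonal_def inner_diff_left)
    qed
    then have "orthogonal (x - P x) t"
      using B(5) that by (metis orthogonal_to_span)
    then show ?thesis by (simp add: orthogonal_def)
  qed
  moreover have "linear P"
    unfolding P_def by (rule linearI) (simp_all add: inner_left_distrib scaleR_left_distrib sum.distrib scaleR_sum_right)
  moreover have "P x \<in> T" for x
    unfolding P_def using B(1) assms by (intro subspace_sum subspace_scale) auto
  ultimately have "orth_projector T P"
    using assms by (simp add: orth_projector_def)
  then show ?thesis ..
qed

text \<open>Bounds an operator norm through finitely many directions; this suits
  \<open>Cp_on\<close>, which controls derivatives one direction at a time.\<close>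

lemma norm_linear_le_sum_Basis:
  fixes f :: "'a::euclidean_space \<Rightarrow> 'b::real_normed_vector"
  assumes "linear f"
  shows "norm (f x) \<le> (\<Sum>b\<in>Basis. norm (f b)) * norm x"
proof -
  have "f x = (\<Sum>b\<in>Basis. (x \<bullet> b) *\<^sub>R f b)"
    using assms by (metis (no_types, lifting) euclidean_representation linear_scale linear_sum sum.cong)
  also have "norm \<dots> \<le> (\<Sum>b\<in>Basis. norm x * norm (f b))"
    by (intro sum_norm_le) (auto intro!: mult_right_mono Basis_le_norm)
  finally show ?thesis
    by (simp add: sum_distrib_left sum_distrib_right mult.commute)
qed

text \<open>Since \<open>A\<close> itself competes, closest points to points near \<open>A\<close>
  stay near \<open>A\<close>, at the cost of doubling the radius.\<close>

lemma dist_closest_less: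
  assumes "A \<in> M" "\<forall>p\<in>M. dist B q \<le> dist B p" "dist A B < \<delta>"
  shows "dist A q < 2 * \<delta>"
proof -
  have "dist A q \<le> dist A B + dist B q" by (rule dist_triangle)
  also have "dist B q \<le> dist A B"
    using assms(1,2) by (simp add: dist_commute)
  finally show ?thesis using assms(3) by simp
qed

section \<open>Charts with Lipschitz derivative\<close>

text \<open>The lower bound is stated at \<open>0\<close> only; the Lipschitz bound propagates it to
  small parameters. The condition \<open>chart_onto\<close> is what remains of the homeomorphism:
  parameters near \<open>0\<close> already cover all points of \<open>M\<close> near
  \<open>A\<close>.\<close>

locale C11_chart =
  fixes M :: "'a::euclidean_space set" and A :: 'a and V :: "'a set" and r :: real
    and \<phi> :: "'a \<Rightarrow> 'a" and D :: "'a \<Rightarrow> 'a \<Rightarrow> 'a" and L l :: real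
  assumes subspace_V: "subspace V"
    and r_pos: "0 < r" and L_pos: "0 < L" and l_pos: "0 < l"
    and chart_0: "\<phi> 0 = A"
    and deriv: "x \<in> V \<inter> ball 0 r \<Longrightarrow> (\<phi> has_derivative D x) (at x within V \<inter> ball 0 r)"
    and deriv_Lipschitz: "\<lbrakk>x \<in> V \<inter> ball 0 r; y \<in> V \<inter> ball 0 r\<rbrakk>
      \<Longrightarrow> norm (D x v - D y v) \<le> L * norm (x - y) * norm v"
    and deriv_lower: "v \<in> V \<Longrightarrow> l * norm v \<le> norm (D 0 v)"
    and chart_in: "x \<in> V \<inter> ball 0 r \<Longrightarrow> \<phi> x \<in> M"
    and chart_onto: "0 < \<rho> \<Longrightarrow> \<exists>\<delta>>0. M \<inter> ball A \<delta> \<subseteq> \<phi> ` (V \<inter> ball 0 \<rho>)"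

text \<open>Halving the radius leaves a compact convex set \<open>K\<close> of parameters. Second
  derivatives are continuous, hence bounded on \<open>K\<close>, so by the mean value inequality
  each directional derivative is Lipschitz there; summing over a basis gives one constant
  \<open>L\<close>. Injectivity of the derivative at \<open>0\<close> gives \<open>l\<close>, by
  finite dimension.\<close>

lemma C11_chart_exists:
  assumes "local_param 2 m M A V r \<phi>"
  obtains \<rho> D L l where "C11_chart M A V \<rho> \<phi> D L l"
    "D 0 ` V = frechet_derivative \<phi> (at 0 within V \<inter> ball 0 r) ` V"
proof -
  define U where "U = V \<inter> ball 0 r"
  have sub: "subspace V" and r: "0 < r" and phi0: "\<phi> 0 = A"
    and C2: "Cp_on 2 V U \<phi>"
    and inj: "\<And>x. x \<in> U \<Longrightarrow> inj_on (frechet_derivative \<phi> (at x within U)) V"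
    and opn: "openin (top_of_set M) (\<phi> ` U)" and "\<exists>\<psi>. homeomorphism U (\<phi> ` U) \<phi> \<psi>"
    using assms by (auto simp: local_param_def U_def Let_def)
  then obtain \<psi> where hom: "homeomorphism U (\<phi> ` U) \<phi> \<psi>" by blast
  obtain P where "orth_projector V P"
    using orth_projector_exists sub by blast
  then interpret P: orth_projector V P .
  have U0: "0 \<in> U" using r sub by (simp add: U_def subspace_0)
  define F where "F x = frechet_derivative \<phi> (at x within U)" for x
  define E where "E v x = frechet_derivative (\<lambda>x. F x v) (at x within U)" for v x
  \<comment> \<open>A derivative within \<open>U\<close> is determined on \<open>V\<close> only.
    Precomposing with \<open>P\<close> fixes its values elsewhere, so that a Lipschitz bound can
    hold in every direction \<open>v\<close>.\<close>
  define D where "D x v = F x (P v)" for x v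
  have C2': "\<And>x. x \<in> U \<Longrightarrow> \<phi> differentiable (at x within U)"
    "\<And>v x. v \<in> V \<Longrightarrow> x \<in> U \<Longrightarrow> (\<lambda>x. F x v) differentiable (at x within U)"
    "\<And>v w. v \<in> V \<Longrightarrow> w \<in> V \<Longrightarrow> continuous_on U (\<lambda>x. E v x w)"
    using C2 by (auto simp: numeral_2_eq_2 F_def E_def)
  \<comment> \<open>The projector fixes every point of \<open>U\<close>, so \<open>f\<close> and its
    composition with \<open>P\<close> agree there.\<close>
  have proj: "(f has_derivative (\<lambda>v. f' (P v))) (at x within U)"
    if "(f has_derivative f') (at x within U)" "x \<in> U" for f :: "'a \<Rightarrow> 'a" and f' x
  proof -
    have "((\<lambda>z. f (P z)) has_derivative (\<lambda>v. f' (P v))) (at x within U)"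
    proof (rule has_derivative_in_compose[of P P _ _ f f'])
      show "(P has_derivative P) (at x within U)"
        by (simp add: P.linear_P linear_imp_has_derivative)
      have "P ` U = U"
        using P.P_fixed by (force simp: U_def)
      then show "(f has_derivative f') (at (P x) within P ` U)"
        using that P.P_fixed by (simp add: U_def)
    qed
    then show ?thesis
      by (rule has_derivative_transform[OF that(2), rotated]) (simp add: P.P_fixed U_def)
  qed
  have F_der: "(\<phi> has_derivative F x) (at x within U)" if "x \<in> U" for x
    using C2'(1)[OF that] by (simp add: F_def frechet_derivative_works)
  have D_der: "(\<phi> has_derivative D x) (at x within U)" if "x \<in> U" for x
    using proj[OF F_der[OF that] that] by (simp add: D_def[abs_def])
  have F_lin: "linear (F x)" if "x \<in> U" for x
    using F_der[OF that] by (rule has_derivative_linear)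
  have D_lin: "linear (D x)" if "x \<in> U" for x
    using D_der[OF that] by (rule has_derivative_linear)
  define K where "K = V \<inter> cball 0 (r/2)"
  have KU: "K \<subseteq> U" using r by (auto simp: K_def U_def)
  have compK: "compact K"
    unfolding K_def using closed_subspace[OF sub] by (simp add: closed_Int_compact)
  have convK: "convex K"
    unfolding K_def by (simp add: convex_Int subspace_imp_convex sub)
  have "\<exists>C\<ge>0. \<forall>x\<in>K. \<forall>y\<in>K. norm (F x v - F y v) \<le> C * norm (x - y)" if v: "v \<in> V" for v
  proof -
    define g where "g x = (\<Sum>b\<in>Basis. norm (E v x (P b)))" for x
    have "continuous_on K g"
      unfolding g_def using C2'(3)[OF v P.P_in] KU
      by (intro continuous_on_sum continuous_on_norm) (blast intro: continuous_on_subset)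
    then have "bounded (g ` K)"
      using compK compact_continuous_image compact_imp_bounded by blast
    then obtain C where C: "\<And>x. x \<in> K \<Longrightarrow> norm (g x) \<le> C"
      by (auto simp: bounded_iff)
    have "norm (F x v - F y v) \<le> C * norm (x - y)" if "x \<in> K" "y \<in> K" for x y
    proof (rule differentiable_bound[OF convK _ _ that])
      fix x assume x: "x \<in> K"
      have "((\<lambda>x. F x v) has_derivative E v x) (at x within U)"
        using C2'(2)[OF v] x KU by (auto simp: E_def frechet_derivative_works)
      from proj[OF this] have der: "((\<lambda>x. F x v) has_derivative (\<lambda>w. E v x (P w))) (at x within U)"
        using x KU by auto
      then show "((\<lambda>x. F x v) has_derivative (\<lambda>w. E v x (P w))) (at x within K)"
        using KU has_derivative_subset by blast
      have "norm (E v x (P w)) \<le> g x * norm w" for w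
        using norm_linear_le_sum_Basis[OF has_derivative_linear[OF der], of w] by (simp add: g_def)
      then have "onorm (\<lambda>w. E v x (P w)) \<le> g x"
        by (rule onorm_le)
      then show "onorm (\<lambda>w. E v x (P w)) \<le> C"
        using C[OF x] by simp
    qed
    moreover have "0 \<le> C"
      using C[of 0] norm_ge_zero order_trans r sub by (fastforce simp: K_def subspace_0)
    ultimately show ?thesis by blast
  qed
  then obtain C where C: "\<And>v. v \<in> V \<Longrightarrow> 0 \<le> C v"
    "\<And>v x y. \<lbrakk>v \<in> V; x \<in> K; y \<in> K\<rbrakk> \<Longrightarrow> norm (F x v - F y v) \<le> C v * norm (x - y)"
    by metis
  \<comment> \<open>The summand \<open>1\<close> only ensures positivity.\<close>
  define L where "L = 1 + (\<Sum>b\<in>Basis. C (P b))"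
  have "0 < L"
    unfolding L_def using C(1)[OF P.P_in] by (simp add: add_pos_nonneg sum_nonneg)
  have lip: "norm (D x v - D y v) \<le> L * norm (x - y) * norm v" if "x \<in> K" "y \<in> K" for x y v
  proof -
    have "linear (\<lambda>v. D x v - D y v)"
      using that KU by (intro linear_compose_sub D_lin) auto
    then have "norm (D x v - D y v) \<le> (\<Sum>b\<in>Basis. norm (D x b - D y b)) * norm v"
      by (rule norm_linear_le_sum_Basis)
    also have "\<dots> \<le> (\<Sum>b\<in>Basis. C (P b) * norm (x - y)) * norm v"
      using C(2)[OF P.P_in that] by (intro mult_right_mono sum_mono) (auto simp: D_def)
    also have "\<dots> \<le> L * norm (x - y) * norm v"
      by (intro mult_right_mono) (simp_all add: L_def sum_distrib_right[symmetric] mult_right_mono)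
    finally show ?thesis .
  qed
  have "\<exists>l>0. \<forall>v\<in>V. l * norm v \<le> norm (F 0 v)"
  proof (rule injective_imp_isometric)
    show "closed V" "subspace V" using sub closed_subspace by auto
    show "bounded_linear (F 0)" using F_der[OF U0] by (rule has_derivative_bounded_linear)
    show "\<forall>x\<in>V. F 0 x = 0 \<longrightarrow> x = 0"
      using inj[OF U0] sub F_lin[OF U0] linear_0 subspace_0
      by (metis F_def inj_onD)
  qed
  then obtain l where l: "0 < l" "\<And>v. v \<in> V \<Longrightarrow> l * norm v \<le> norm (F 0 v)" by blast
  have "C11_chart M A V (r/2) \<phi> D L l"
  proof
    show "subspace V" "0 < r/2" "0 < L" "0 < l" "\<phi> 0 = A"
      using sub r \<open>0 < L\<close> l phi0 by auto
    have sub': "V \<inter> ball 0 (r/2) \<subseteq> K" by (auto simp: K_def)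
    show "(\<phi> has_derivative D x) (at x within V \<inter> ball 0 (r/2))" if "x \<in> V \<inter> ball 0 (r/2)" for x
      using D_der[of x] that sub' KU by (meson has_derivative_subset subset_iff subset_trans)
    show "norm (D x v - D y v) \<le> L * norm (x - y) * norm v"
      if "x \<in> V \<inter> ball 0 (r/2)" "y \<in> V \<inter> ball 0 (r/2)" for x y v
      using that sub' by (intro lip) auto
    show "l * norm v \<le> norm (D 0 v)" if "v \<in> V" for v
      using l(2)[OF that] that by (simp add: D_def P.P_fixed)
    have "\<phi> ` U \<subseteq> M" using opn openin_imp_subset by blast
    then show "\<phi> x \<in> M" if "x \<in> V \<inter> ball 0 (r/2)" for x
      using that sub' KU by blast
    show "\<exists>\<delta>>0. M \<inter> ball A \<delta> \<subseteq> \<phi> ` (V \<inter> ball 0 \<rho>)" if "0 < \<rho>" for \<rho>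
    proof -
      have "openin (top_of_set U) (U \<inter> ball 0 \<rho>)"
        by (simp add: openin_open_Int)
      then have "openin (top_of_set (\<phi> ` U)) (\<phi> ` (U \<inter> ball 0 \<rho>))"
        using hom homeomorphism_imp_open_map by blast
      then have "openin (top_of_set M) (\<phi> ` (U \<inter> ball 0 \<rho>))"
        using opn openin_trans by blast
      moreover have "A \<in> \<phi> ` (U \<inter> ball 0 \<rho>)"
        using U0 that phi0 by force
      ultimately obtain \<delta> where "0 < \<delta>" "ball A \<delta> \<inter> M \<subseteq> \<phi> ` (U \<inter> ball 0 \<rho>)"
        by (meson openin_contains_ball)
      then show ?thesis
        by (intro exI[of _ \<delta>]) (auto simp: U_def)
    qed
  qed
  moreover have "D 0 ` V = F 0 ` V"
    by (rule image_cong) (simp_all add: D_def P.P_fixed)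
  ultimately show ?thesis
    using that by (simp add: F_def U_def)
qed

text \<open>The local properties of \<open>M\<close> on which the convergence argument rests, all in
  terms of the one projector \<open>P\<close> at \<open>A\<close>. In \<open>lift\<close> the
  projection of \<open>B - A\<close> is exactly \<open>x\<close>, not just close to it: this keeps
  orthogonality to subspaces of \<open>T\<close> when a tangent vector is replaced by a point of
  \<open>M\<close>.\<close>

locale tame_at = orth_projector T P
  for T :: "'a::euclidean_space set" and P :: "'a \<Rightarrow> 'a" +
  fixes M :: "'a set" and A :: 'a
  assumes closed_M: "closed M"
    and A_in: "A \<in> M"
    and secant: "0 < e \<Longrightarrow> \<exists>\<delta>>0. \<forall>p\<in>M \<inter> ball A \<delta>. \<forall>q\<in>M \<inter> ball A \<delta>.
      norm ((q - p) - P (q - p)) \<le> e * norm (q - p)"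
    and normal: "0 < e \<Longrightarrow> \<exists>\<delta>>0. \<forall>B\<in>ball A \<delta>. \<forall>q\<in>M. (\<forall>p\<in>M. dist B q \<le> dist B p) \<longrightarrow>
      norm (P (B - q)) \<le> e * norm (B - q)"
    and unique: "\<exists>\<delta>>0. \<forall>B\<in>ball A \<delta>. proj_defined M B"
    and lift: "0 < e \<Longrightarrow> \<exists>\<delta>>0. \<forall>x\<in>T. norm x < \<delta> \<longrightarrow> (\<exists>B\<in>M. norm (B - A) < e \<and> P (B - A) = x)"

context C11_chart
begin

lemma zero_dom: "0 \<in> V \<inter> ball 0 r"
  using r_pos subspace_V by (simp add: subspace_0)

lemma linear_D: "x \<in> V \<inter> ball 0 r \<Longrightarrow> linear (D x)"
  using deriv has_derivative_linear by blast

text \<open>Mean value inequality for \<open>\<phi>\<close> minus the linear map \<open>D z\<close>,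
  whose derivative on \<open>S\<close> has norm at most \<open>L * R\<close>.\<close>

lemma increment:
  assumes "S \<subseteq> V \<inter> ball 0 r" "convex S" "x \<in> S" "y \<in> S" "z \<in> S"
    and "\<And>w. w \<in> S \<Longrightarrow> norm (w - z) \<le> R"
  shows "norm (\<phi> y - \<phi> x - D z (y - x)) \<le> L * R * norm (y - x)"
proof -
  have "norm (\<phi> y - \<phi> x - D z (y - x)) \<le> norm (y - x) * (L * R)"
  proof (rule differentiable_bound_linearization[where S = S and f' = D])
    show "x + t *\<^sub>R (y - x) \<in> S" if "t \<in> {0..1}" for t
    proof -
      have "x + t *\<^sub>R (y - x) = (1 - t) *\<^sub>R x + t *\<^sub>R y"
        by (simp add: algebra_simps)
      then show ?thesis using that assms by (simp add: convexD_alt)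
    qed
    show "(\<phi> has_derivative D w) (at w within S)" if "w \<in> S" for w
      using deriv[of w] that assms(1) has_derivative_subset by blast
    show "onorm (D w - D z) \<le> L * R" if "w \<in> S" for w
    proof (rule onorm_le)
      fix v
      have "w \<in> V \<inter> ball 0 r" "z \<in> V \<inter> ball 0 r"
        using that assms(1,5) by blast+
      then have "norm (D w v - D z v) \<le> L * norm (w - z) * norm v"
        by (rule deriv_Lipschitz)
      then have "norm ((D w - D z) v) \<le> L * norm (w - z) * norm v"
        by simp
      also have "\<dots> \<le> L * R * norm v"
        using assms(6)[OF that] L_pos by (intro mult_right_mono mult_left_mono) auto
      finally show "norm ((D w - D z) v) \<le> L * R * norm v" .
    qed
  qed (use assms in auto)
  then show ?thesis by (simp add: mult.commute)
qed

lemma increment_at_0: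
  assumes "\<rho> \<le> r" "x \<in> V \<inter> ball 0 \<rho>" "y \<in> V \<inter> ball 0 \<rho>"
  shows "norm (\<phi> y - \<phi> x - D 0 (y - x)) \<le> L * \<rho> * norm (y - x)"
proof -
  have "0 < \<rho>"
    using assms(2) norm_ge_zero[of x] by (simp del: norm_ge_zero)
  then have "0 \<in> V \<inter> ball 0 \<rho>"
    using subspace_V by (simp add: subspace_0)
  moreover have "V \<inter> ball 0 \<rho> \<subseteq> V \<inter> ball 0 r" using assms(1) by auto
  moreover have "convex (V \<inter> ball 0 \<rho>)"
    by (simp add: convex_Int subspace_V subspace_imp_convex)
  ultimately show ?thesis
    using increment[of "V \<inter> ball 0 \<rho>" x y 0 \<rho>] assms(2,3) by simp
qed

text \<open>The map \<open>D 0\<close> stretches by at least \<open>l\<close>, and the linearization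
  error uses up at most half of that.\<close>

lemma expansion:
  assumes "\<rho> \<le> r" "2 * (L * \<rho>) \<le> l" "x \<in> V \<inter> ball 0 \<rho>" "y \<in> V \<inter> ball 0 \<rho>"
  shows "l * norm (y - x) \<le> 2 * norm (\<phi> y - \<phi> x)"
proof -
  have "l * norm (y - x) \<le> norm (D 0 (y - x))"
    using assms subspace_V by (simp add: deriv_lower subspace_diff)
  also have "\<dots> \<le> norm (\<phi> y - \<phi> x) + norm (\<phi> y - \<phi> x - D 0 (y - x))"
    by (metis add.commute norm_minus_commute norm_triangle_sub)
  also have "norm (\<phi> y - \<phi> x - D 0 (y - x)) \<le> L * \<rho> * norm (y - x)"
    by (rule increment_at_0) (use assms in auto)
  finally have "2 * (l * norm (y - x)) \<le> 2 * norm (\<phi> y - \<phi> x) + 2 * (L * \<rho>) * norm (y - x)"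
    by simp
  also have "2 * (L * \<rho>) * norm (y - x) \<le> l * norm (y - x)"
    using assms(2) by (intro mult_right_mono) auto
  finally show ?thesis by simp
qed

text \<open>On the segment from \<open>x\<close> to \<open>y\<close> the radius \<open>R\<close> is
  \<open>norm (y - x)\<close>. The resulting quadratic error is what makes closest points
  unique.\<close>

lemma increment_at_point:
  assumes "x \<in> V \<inter> ball 0 r" "y \<in> V \<inter> ball 0 r"
  shows "norm (\<phi> y - \<phi> x - D x (y - x)) \<le> L * (norm (y - x))\<^sup>2"
proof -
  have "convex (V \<inter> ball 0 r)"
    by (simp add: convex_Int subspace_V subspace_imp_convex)
  then have "closed_segment x y \<subseteq> V \<inter> ball 0 r"
    by (rule closed_segment_subset[OF assms])
  from increment[OF this convex_closed_segment ends_in_segment(1,2,1) segment_bound(1)]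
  have "norm (\<phi> y - \<phi> x - D x (y - x)) \<le> L * norm (y - x) * norm (y - x)" .
  then show ?thesis by (simp only: power2_eq_square mult.assoc)
qed

text \<open>First-order condition: the squared distance from \<open>B\<close> to
  \<open>\<phi> (x + t *\<^sub>R v)\<close> has a local minimum at \<open>t = 0\<close>.\<close>

lemma closest_orth:
  assumes "x \<in> V \<inter> ball 0 r" "\<And>p. p \<in> M \<Longrightarrow> dist B (\<phi> x) \<le> dist B p" "v \<in> V"
  shows "(B - \<phi> x) \<bullet> D x v = 0"
proof -
  define S where "S = {t. norm (x + t *\<^sub>R v) < r}"
  define f where "f t = \<phi> (x + t *\<^sub>R v)" for t
  define g where "g t = (B - f t) \<bullet> (B - f t)" for t
  have "open S"
    unfolding S_def by (intro open_Collect_less continuous_intros)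
  have "0 \<in> S" using assms(1) by (simp add: S_def)
  have sub: "(\<lambda>t. x + t *\<^sub>R v) ` S \<subseteq> V \<inter> ball 0 r"
    using assms subspace_V by (auto simp: S_def subspace_add subspace_scale)
  have "(f has_derivative (\<lambda>t. D (x + 0 *\<^sub>R v) (t *\<^sub>R v))) (at 0 within S)"
    unfolding f_def
    by (rule has_derivative_in_compose2[OF deriv sub \<open>0 \<in> S\<close>])
      (auto intro!: derivative_eq_intros)
  then have f': "(f has_derivative (\<lambda>t. t *\<^sub>R D x v)) (at 0)"
    unfolding at_within_open[OF \<open>0 \<in> S\<close> \<open>open S\<close>]
    by (rule has_derivative_eq_rhs) (simp add: fun_eq_iff linear_scale[OF linear_D[OF assms(1)]])
  have f0: "f 0 = \<phi> x" by (simp add: f_def)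
  have "(g has_derivative (\<lambda>t. (B - f 0) \<bullet> (0 - t *\<^sub>R D x v) + (0 - t *\<^sub>R D x v) \<bullet> (B - f 0))) (at 0)"
    unfolding g_def by (intro has_derivative_inner has_derivative_diff has_derivative_const f')
  then have "(g has_derivative (*) (- 2 * ((B - \<phi> x) \<bullet> D x v))) (at 0)"
    by (rule has_derivative_eq_rhs) (simp add: f0 fun_eq_iff inner_commute)
  then have g': "(g has_real_derivative - 2 * ((B - \<phi> x) \<bullet> D x v)) (at 0)"
    by (simp add: has_field_derivative_def)
  obtain d where d: "0 < d" "ball 0 d \<subseteq> S"
    using \<open>open S\<close> \<open>0 \<in> S\<close> open_contains_ball by blast
  have "g 0 \<le> g t" if "\<bar>0 - t\<bar> < d" for t
  proof -
    have "t \<in> S" using that d(2) by (auto simp: dist_norm)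
    then have "f t \<in> M" unfolding f_def using sub chart_in by blast
    then show ?thesis
      using assms(2)[of "f t"] by (simp add: g_def f0 dist_norm norm_le)
  qed
  then show ?thesis
    using DERIV_local_min[OF g' d(1)] by simp
qed

lemma A_in: "A \<in> M"
  using chart_in[OF zero_dom] chart_0 by simp

lemma tame:
  assumes P: "orth_projector (D 0 ` V) P" and closed: "closed M"
  shows "tame_at (D 0 ` V) P M A"
proof -
  interpret P: orth_projector "D 0 ` V" P by fact
  have lin0: "linear (D 0)" using linear_D zero_dom by blast
  show ?thesis
  proof
    show "closed M" "A \<in> M" by (fact closed A_in)+
  next

    \<comment> \<open>Secants and residuals\<close>
    fix e :: real assume e: "0 < e"
    \<comment> \<open>The second entry makes \<open>\<phi>\<close> expanding; the third keeps the
      variation \<open>L * \<rho>\<close> of the derivative below \<open>e * l / 2\<close>.\<close>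
    define \<rho> where "\<rho> = min r (min (l / (2 * L)) (e * l / (2 * L)))"
    have \<rho>: "0 < \<rho>" "\<rho> \<le> r" "2 * (L * \<rho>) \<le> l" "2 * (L * \<rho>) \<le> e * l"
    proof -
      show "0 < \<rho>" "\<rho> \<le> r" using r_pos L_pos l_pos e by (auto simp: \<rho>_def)
      have "\<rho> \<le> l / (2 * L)" "\<rho> \<le> e * l / (2 * L)" by (auto simp: \<rho>_def)
      then show "2 * (L * \<rho>) \<le> l" "2 * (L * \<rho>) \<le> e * l"
        using L_pos by (auto simp: pos_le_divide_eq mult.commute mult.left_commute)
    qed
    obtain \<delta> where \<delta>: "0 < \<delta>" "M \<inter> ball A \<delta> \<subseteq> \<phi> ` (V \<inter> ball 0 \<rho>)"
      using chart_onto \<rho>(1) by blast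
    show "\<exists>\<delta>>0. \<forall>p\<in>M \<inter> ball A \<delta>. \<forall>q\<in>M \<inter> ball A \<delta>.
      norm ((q - p) - P (q - p)) \<le> e * norm (q - p)"
    proof (intro exI[of _ \<delta>] conjI ballI \<delta>(1))
      fix p q assume "p \<in> M \<inter> ball A \<delta>" "q \<in> M \<inter> ball A \<delta>"
      then obtain x y where x: "p = \<phi> x" "x \<in> V \<inter> ball 0 \<rho>" and y: "q = \<phi> y" "y \<in> V \<inter> ball 0 \<rho>"
        using \<delta>(2) by blast
      have "y - x \<in> V" using x y subspace_V by (simp add: subspace_diff)
      \<comment> \<open>The linear part of the increment is tangent, so only the linearization error
        contributes to the residual of \<open>q - p\<close>.\<close>
      then have fixed: "P (D 0 (y - x)) = D 0 (y - x)"
        by (intro P.P_fixed) auto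
      have "norm ((q - p) - P (q - p)) = norm ((q - p - D 0 (y - x)) - P (q - p - D 0 (y - x)))"
        by (simp add: P.P_diff[of "q - p"] fixed)
      also have "\<dots> \<le> norm (q - p - D 0 (y - x))"
        by (rule P.norm_residual_le)
      also have "\<dots> \<le> L * \<rho> * norm (y - x)"
        unfolding x y by (rule increment_at_0) (use \<rho> x y in auto)
      finally have "2 * norm ((q - p) - P (q - p)) \<le> 2 * (L * \<rho>) * norm (y - x)" by simp
      also have "\<dots> \<le> e * l * norm (y - x)"
        using \<rho>(4) by (intro mult_right_mono) auto
      also have "\<dots> \<le> e * (2 * norm (q - p))"
        using expansion[OF \<rho>(2,3) x(2) y(2)] e unfolding x y mult.assoc by (intro mult_left_mono) auto
      finally show "norm ((q - p) - P (q - p)) \<le> e * norm (q - p)" by simp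
    qed
    show "\<exists>\<delta>>0. \<forall>B\<in>ball A \<delta>. \<forall>q\<in>M. (\<forall>p\<in>M. dist B q \<le> dist B p) \<longrightarrow>
      norm (P (B - q)) \<le> e * norm (B - q)"
    proof (intro exI[of _ "\<delta> / 2"] conjI ballI impI)
      fix B q assume B: "B \<in> ball A (\<delta> / 2)" and q: "q \<in> M" "\<forall>p\<in>M. dist B q \<le> dist B p"
      then have "q \<in> ball A \<delta>"
        using dist_closest_less[OF A_in q(2), of "\<delta> / 2"] by simp
      then obtain x where x: "q = \<phi> x" "x \<in> V \<inter> ball 0 \<rho>"
        using \<delta>(2) q(1) by blast
      have x': "x \<in> V \<inter> ball 0 r" using x \<rho>(2) by auto
      show "norm (P (B - q)) \<le> e * norm (B - q)"
      proof (rule P.norm_P_leI)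
        fix t assume "t \<in> D 0 ` V"
        then obtain v where v: "v \<in> V" "t = D 0 v" by blast
        \<comment> \<open>The residual is exactly orthogonal to the tangent space at
          \<open>q\<close>, so only the rotation of the tangent space between \<open>A\<close> and
          \<open>q\<close> remains.\<close>
        have "(B - q) \<bullet> t = (B - q) \<bullet> (D 0 v - D x v)"
          using closest_orth[OF x' _ v(1), of B] q x v by (simp add: inner_diff_right)
        then have "\<bar>(B - q) \<bullet> t\<bar> \<le> norm (B - q) * norm (D 0 v - D x v)"
          using Cauchy_Schwarz_ineq2 by metis
        also have "\<dots> \<le> norm (B - q) * (L * norm (0 - x) * norm v)"
          by (intro mult_left_mono deriv_Lipschitz zero_dom x') auto
        also have "\<dots> \<le> norm (B - q) * (e * l * norm v)"
        proof (intro mult_left_mono mult_right_mono)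
          have "L * norm x \<le> L * \<rho>" using x(2) L_pos by auto
          moreover have "0 \<le> L * \<rho>" using L_pos \<rho> by simp
          ultimately show "L * norm (0 - x) \<le> e * l" using \<rho>(4) by simp
        qed auto
        also have "\<dots> \<le> norm (B - q) * (e * norm t)"
          using deriv_lower[OF v(1)] e unfolding v(2) mult.assoc by (intro mult_left_mono) auto
        finally show "\<bar>(B - q) \<bullet> t\<bar> \<le> e * norm (B - q) * norm t"
          by (simp add: mult_ac)
      qed (use e in simp)
    qed (use \<delta> in auto)
  next

    \<comment> \<open>Uniqueness of closest points\<close>
    define \<rho> where "\<rho> = min r (l / (2 * L))"
    have \<rho>: "0 < \<rho>" "\<rho> \<le> r" "2 * (L * \<rho>) \<le> l"
    proof -
      show "0 < \<rho>" "\<rho> \<le> r" using r_pos L_pos l_pos by (auto simp: \<rho>_def)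
      have "\<rho> \<le> l / (2 * L)" by (auto simp: \<rho>_def)
      then show "2 * (L * \<rho>) \<le> l"
        using L_pos by (auto simp: pos_le_divide_eq mult.commute mult.left_commute)
    qed
    obtain \<delta> where \<delta>: "0 < \<delta>" "M \<inter> ball A \<delta> \<subseteq> \<phi> ` (V \<inter> ball 0 \<rho>)"
      using chart_onto \<rho>(1) by blast
    \<comment> \<open>If \<open>p\<close> and \<open>q\<close> are both closest to \<open>B\<close>,
      then the square of \<open>norm (q - p)\<close> equals
      \<open>2 * ((B - p) \<bullet> (q - p))\<close>. By orthogonality at \<open>p\<close>, the
      quadratic error and expansion, this is at most \<open>8 * L / l\<^sup>2 * norm (B - p)\<close>
      times that same square. Below the threshold chosen here the factor is less than
      \<open>1\<close>, which forces \<open>p = q\<close>.\<close>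
    define \<eta> where "\<eta> = min (\<delta> / 2) (l\<^sup>2 / (8 * L))"
    show "\<exists>\<delta>>0. \<forall>B\<in>ball A \<delta>. proj_defined M B"
    proof (intro exI[of _ \<eta>] conjI ballI)
      show "0 < \<eta>" using \<delta> L_pos l_pos by (simp add: \<eta>_def)
      fix B assume B: "B \<in> ball A \<eta>"
      show "proj_defined M B"
        unfolding proj_defined_def
      proof (rule ex_ex1I)
        show "\<exists>P. P \<in> M \<and> (\<forall>Q\<in>M. dist B P \<le> dist B Q)"
          using closest_point_exists[OF closed, of B] A_in by blast
        fix p q assume p: "p \<in> M \<and> (\<forall>Q\<in>M. dist B p \<le> dist B Q)"
          and q: "q \<in> M \<and> (\<forall>Q\<in>M. dist B q \<le> dist B Q)"
        have B': "B \<in> ball A (\<delta> / 2)" using B by (simp add: \<eta>_def)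
        have "p \<in> ball A \<delta>" "q \<in> ball A \<delta>"
          using dist_closest_less[OF A_in, of B _ "\<delta> / 2"] B' p q by auto
        then obtain x y where x: "p = \<phi> x" "x \<in> V \<inter> ball 0 \<rho>" and y: "q = \<phi> y" "y \<in> V \<inter> ball 0 \<rho>"
          using \<delta>(2) p q by blast
        have x': "x \<in> V \<inter> ball 0 r" and y': "y \<in> V \<inter> ball 0 r" using x y \<rho>(2) by auto
        have "y - x \<in> V" using x y subspace_V by (simp add: subspace_diff)
        then have "(B - p) \<bullet> (q - p) = (B - p) \<bullet> (\<phi> y - \<phi> x - D x (y - x))"
          using closest_orth[OF x', of B "y - x"] p x y by (simp add: inner_diff_right)
        also have "\<dots> \<le> norm (B - p) * norm (\<phi> y - \<phi> x - D x (y - x))"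
          by (rule norm_cauchy_schwarz)
        also have "\<dots> \<le> norm (B - p) * (L * (norm (y - x))\<^sup>2)"
          by (intro mult_left_mono increment_at_point x' y') auto
        finally have 1: "(B - p) \<bullet> (q - p) \<le> norm (B - p) * (L * (norm (y - x))\<^sup>2)" .
        have "dist B p = dist B q" using p q by (simp add: antisym)
        then have "(B - p) \<bullet> (B - p) = (B - p - (q - p)) \<bullet> (B - p - (q - p))"
          by (simp add: dist_norm norm_eq)
        then have 2: "(norm (q - p))\<^sup>2 = 2 * ((B - p) \<bullet> (q - p))"
          unfolding power2_norm_eq_inner inner_diff_left[of "B - p"] inner_diff_right[of _ "B - p"]
          by (simp add: inner_commute)
        have "l\<^sup>2 * (norm (q - p))\<^sup>2 \<le> l\<^sup>2 * (2 * (norm (B - p) * (L * (norm (y - x))\<^sup>2)))"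
          using 1 2 by (intro mult_left_mono) auto
        also have "\<dots> = 2 * (norm (B - p) * L) * (l * norm (y - x))\<^sup>2"
          by (simp add: power2_eq_square)
        also have "\<dots> \<le> 2 * (norm (B - p) * L) * (2 * norm (q - p))\<^sup>2"
          using expansion[OF \<rho>(2,3) x(2) y(2)] L_pos l_pos unfolding x(1) y(1)
          by (intro mult_left_mono power_mono) auto
        finally have 3: "l\<^sup>2 * (norm (q - p))\<^sup>2 \<le> 8 * (norm (B - p) * L) * (norm (q - p))\<^sup>2"
          by (simp add: power2_eq_square)
        have "norm (B - p) < l\<^sup>2 / (8 * L)"
          using p A_in B by (fastforce simp: \<eta>_def dist_norm norm_minus_commute)
        then have "8 * (norm (B - p) * L) < l\<^sup>2"
          using L_pos by (simp add: pos_less_divide_eq mult_ac)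
        then show "p = q"
          using 3 by (auto simp: mult_le_cancel_right)
      qed
    qed
  next

    \<comment> \<open>Lifting tangent vectors to points of \<open>M\<close>\<close>
    fix e :: real assume e: "0 < e"
    have inj: "inj_on (D 0) V"
    proof (rule inj_onI)
      fix x y assume "x \<in> V" "y \<in> V" "D 0 x = D 0 y"
      then have "l * norm (x - y) \<le> norm (D 0 (x - y))" "D 0 (x - y) = 0"
        using deriv_lower[of "x - y"] subspace_V by (auto simp: subspace_diff linear_diff[OF lin0])
      then show "x = y" using l_pos by (simp add: mult_le_0_iff)
    qed
    obtain h where h: "range h \<subseteq> V" "linear h" "\<And>v. v \<in> V \<Longrightarrow> h (D 0 v) = v"
      using linear_exists_left_inverse_on[OF lin0 subspace_V inj] by blast
    \<comment> \<open>A linear map from the whole space to parameters with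
      \<open>D 0 (k z) = P z\<close>, so that \<open>\<phi> (k z) - A\<close> has derivative
      \<open>P\<close> at \<open>0\<close>.\<close>
    define k where "k z = h (P z)" for z
    have kin: "k z \<in> V" for z using h(1) by (auto simp: k_def)
    have Dk: "D 0 (k z) = P z" for z
      using P.P_in[of z] h(3) by (auto simp: k_def)
    have lk: "linear k"
      using linear_compose[OF P.linear_P h(2)] by (simp add: k_def[abs_def] o_def)
    have ck: "continuous_on S k" for S
      using lk linear_continuous_on linear_conv_bounded_linear by blast
    have Pc: "continuous_on S P" for S
      using P.linear_P linear_continuous_on linear_conv_bounded_linear by blast
    have phic: "continuous_on (V \<inter> ball 0 r) \<phi>"
      using deriv has_derivative_continuous_on by blast
    define \<Omega> where "\<Omega> = k -` ball 0 r"
    have op: "open \<Omega>" unfolding \<Omega>_def using ck by (intro open_vimage) auto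
    have k0: "k 0 = 0" using lk by (rule linear_0)
    have 0: "0 \<in> \<Omega>" using k0 r_pos by (simp add: \<Omega>_def)
    have kO: "k ` \<Omega> \<subseteq> V \<inter> ball 0 r" using kin by (auto simp: \<Omega>_def)
    have cphik: "continuous_on \<Omega> (\<lambda>z. \<phi> (k z))"
      by (rule continuous_on_compose2[OF phic ck kO])
    \<comment> \<open>The summand \<open>z - P z\<close> makes the derivative at \<open>0\<close> the identity of the whole space, so that the
      open mapping theorem applies.\<close>
    define f where "f z = P (\<phi> (k z) - A) + (z - P z)" for z
    have contf: "continuous_on \<Omega> f"
      unfolding f_def
      by (intro continuous_intros continuous_on_compose2[OF Pc[of UNIV]] cphik Pc) auto
    have "((\<lambda>z. \<phi> (k z)) has_derivative (\<lambda>w. D (k 0) (k w))) (at 0 within \<Omega>)"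
      by (rule has_derivative_in_compose2[OF deriv kO 0 linear_imp_has_derivative[OF lk]])
    then have "((\<lambda>z. \<phi> (k z)) has_derivative P) (at 0)"
      unfolding at_within_open[OF 0 op] k0 Dk .
    then have "((\<lambda>z. \<phi> (k z) - A) has_derivative P) (at 0)"
      by (auto intro: derivative_eq_intros)
    from bounded_linear.has_derivative[OF P.linear_P[unfolded linear_conv_bounded_linear] this]
    have "((\<lambda>z. P (\<phi> (k z) - A)) has_derivative P) (at 0)"
      by (simp add: P.P_idem)
    then have "(f has_derivative (\<lambda>w. P w + (w - P w))) (at 0)"
      unfolding f_def
      by (intro has_derivative_add has_derivative_diff has_derivative_ident
          linear_imp_has_derivative P.linear_P)
    then have derf: "(f has_derivative (\<lambda>w. w)) (at 0)" by simp
    \<comment> \<open>Restricting to \<open>S\<close> before applying the open mapping theorem keeps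
      the lifted point within \<open>e\<close> of \<open>A\<close>.\<close>
    define S where "S = \<Omega> \<inter> (\<lambda>z. \<phi> (k z)) -` ball A e"
    have "open S"
      unfolding S_def using continuous_open_preimage[OF cphik op, of "ball A e"] by simp
    moreover have "0 \<in> S" using 0 e by (simp add: S_def k0 chart_0)
    ultimately have "0 \<in> interior S" by (simp add: interior_open)
    then have "f 0 \<in> interior (f ` S)"
      by (intro sussmann_open_mapping[OF op contf 0 derf, of "\<lambda>w. w"])
        (auto simp: S_def o_def id_def)
    moreover have "f 0 = 0" by (simp add: f_def k0 chart_0 P.P_zero)
    ultimately obtain \<delta> where \<delta>: "0 < \<delta>" "ball 0 \<delta> \<subseteq> f ` S"
      by (auto simp: mem_interior)
    show "\<exists>\<delta>>0. \<forall>x\<in>D 0 ` V. norm x < \<delta> \<longrightarrow> (\<exists>B\<in>M. norm (B - A) < e \<and> P (B - A) = x)"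
    proof (intro exI[of _ \<delta>] conjI ballI impI \<delta>(1))
      fix x assume x: "x \<in> D 0 ` V" "norm x < \<delta>"
      then obtain z where z: "z \<in> S" "x = f z" using \<delta>(2) by force
      \<comment> \<open>Applying \<open>P\<close> fixes the tangent vector \<open>x\<close> and
        annihilates the auxiliary summand \<open>z - P z\<close>.\<close>
      have "x = P (f z)" using x(1) z(2) P.P_fixed by simp
      also have "\<dots> = P (\<phi> (k z) - A)"
        by (simp add: f_def P.P_add P.P_diff P.P_idem)
      finally have "x = P (\<phi> (k z) - A)" .
      moreover have "\<phi> (k z) \<in> M"
        by (rule chart_in) (use z(1) kO in \<open>auto simp: S_def\<close>)
      ultimately show "\<exists>B\<in>M. norm (B - A) < e \<and> P (B - A) = x"
        using z(1)
        by (intro bexI[of _ "\<phi> (k z)"]) (auto simp: S_def dist_norm norm_minus_commute)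
    qed
  qed
qed

end

section \<open>Closest points and tangent spaces\<close>

context tame_at
begin

text \<open>For the closest point \<open>q\<close>, the error splits into the secant residual of
  \<open>q - p\<close> and the tangential part of \<open>B - q\<close>. Since
  \<open>norm (q - p)\<close> is at most \<open>2 * norm (B - p)\<close>, they contribute
  \<open>2 * e\<close> and \<open>e\<close>.\<close>

lemma projection_approx:
  assumes e: "0 < e"
  shows "\<exists>\<delta>>0. \<forall>B\<in>ball A \<delta>. \<forall>p\<in>M \<inter> ball A \<delta>.
    norm (closest_point M B - p - P (B - p)) \<le> 3 * e * norm (B - p)"
proof -
  obtain \<delta>1 where \<delta>1: "0 < \<delta>1" "\<And>p q. \<lbrakk>p \<in> M \<inter> ball A \<delta>1; q \<in> M \<inter> ball A \<delta>1\<rbrakk> \<Longrightarrow>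
      norm ((q - p) - P (q - p)) \<le> e * norm (q - p)"
    using secant[OF e] by blast
  obtain \<delta>2 where \<delta>2: "0 < \<delta>2" "\<And>B q. \<lbrakk>B \<in> ball A \<delta>2; q \<in> M; \<forall>p\<in>M. dist B q \<le> dist B p\<rbrakk> \<Longrightarrow>
      norm (P (B - q)) \<le> e * norm (B - q)"
    using normal[OF e] by blast
  show ?thesis
  proof (intro exI[of _ "min (\<delta>1 / 2) \<delta>2"] conjI ballI)
    fix B p assume B: "B \<in> ball A (min (\<delta>1 / 2) \<delta>2)" and p: "p \<in> M \<inter> ball A (min (\<delta>1 / 2) \<delta>2)"
    define q where "q = closest_point M B"
    have q: "q \<in> M" "\<forall>p\<in>M. dist B q \<le> dist B p"
      using closest_point_exists[OF closed_M] A_in by (auto simp: q_def)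
    have "q \<in> ball A \<delta>1"
      using dist_closest_less[OF A_in q(2), of "\<delta>1 / 2"] B by simp
    then have 1: "norm ((q - p) - P (q - p)) \<le> e * norm (q - p)"
      using p q \<delta>1(1) by (intro \<delta>1(2)) auto
    have 2: "norm (P (B - q)) \<le> e * norm (B - q)"
      using B q by (intro \<delta>2(2)) auto
    have 3: "norm (B - q) \<le> norm (B - p)"
      using q(2) p by (simp add: dist_norm)
    then have 4: "norm (q - p) \<le> 2 * norm (B - p)"
      using norm_triangle_ineq4[of "B - p" "B - q"] by simp
    have eq: "q - p - P (B - p) = ((q - p) - P (q - p)) - P (B - q)"
      by (simp add: P_diff)
    have "norm (q - p - P (B - p)) \<le> e * norm (q - p) + e * norm (B - q)"
      unfolding eq using 1 2 norm_triangle_ineq4[of "(q - p) - P (q - p)" "P (B - q)"] by linarith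
    also have "\<dots> \<le> e * (2 * norm (B - p)) + e * norm (B - p)"
      using 3 4 e by (intro add_mono mult_left_mono) auto
    finally show "norm (closest_point M B - p - P (B - p)) \<le> 3 * e * norm (B - p)"
      by (simp add: q_def)
  qed (use \<delta>1 \<delta>2 in auto)
qed

text \<open>Every tangent direction is realized, up to a small relative error, by a point of
  \<open>M\<close> arbitrarily near \<open>A\<close>: \<open>lift\<close> supplies the point and
  \<open>secant\<close> bounds the error.\<close>

lemma approach:
  assumes "x \<in> T" "0 < e" "0 < \<eta>"
  obtains t B where "0 < t" "B \<in> M" "norm (B - A) < \<eta>" "P (B - A) = t *\<^sub>R x"
    "norm (B - A - t *\<^sub>R x) \<le> e * norm (B - A)"
proof -
  obtain \<delta> where \<delta>: "0 < \<delta>" "\<And>p q. \<lbrakk>p \<in> M \<inter> ball A \<delta>; q \<in> M \<inter> ball A \<delta>\<rbrakk> \<Longrightarrow>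
      norm ((q - p) - P (q - p)) \<le> e * norm (q - p)"
    using secant[OF assms(2)] by blast
  obtain \<kappa> where \<kappa>: "0 < \<kappa>"
    "\<And>y. \<lbrakk>y \<in> T; norm y < \<kappa>\<rbrakk> \<Longrightarrow> \<exists>B\<in>M. norm (B - A) < min \<delta> \<eta> \<and> P (B - A) = y"
    using lift[of "min \<delta> \<eta>"] \<delta>(1) assms(3) by auto
  \<comment> \<open>Adding \<open>1\<close> covers \<open>x = 0\<close> and makes
    \<open>t *\<^sub>R x\<close> strictly shorter than \<open>\<kappa>\<close>.\<close>
  define t where "t = \<kappa> / (norm x + 1)"
  have n: "0 < norm x + 1" using norm_ge_zero[of x] by linarith
  then have t: "0 < t" using \<kappa>(1) by (simp add: t_def)
  have "norm (t *\<^sub>R x) < \<kappa>"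
    using t n \<kappa>(1) by (simp add: t_def pos_divide_less_eq)
  moreover have "t *\<^sub>R x \<in> T" using assms(1) subspace_T by (simp add: subspace_scale)
  ultimately obtain B where B: "B \<in> M" "norm (B - A) < min \<delta> \<eta>" "P (B - A) = t *\<^sub>R x"
    using \<kappa>(2) by blast
  have "norm ((B - A) - P (B - A)) \<le> e * norm (B - A)"
    using B A_in \<delta>(1) by (intro \<delta>(2)) (auto simp: dist_norm norm_minus_commute)
  then show ?thesis
    using that[OF t B(1)] B(2,3) by simp
qed

end

text \<open>A point of \<open>M\<close> approached in the direction \<open>x\<close> is also a point
  of \<open>M'\<close>, whose secants at \<open>A\<close> are almost in \<open>T'\<close>. Letting
  the error tend to \<open>0\<close> gives \<open>x = P' x\<close>. Only secants enter, so the
  charts behind \<open>T\<close> and \<open>T'\<close> may be unrelated.\<close>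

lemma tangent_mono:
  assumes "tame_at T P M A" "tame_at T' P' M' A" "M \<subseteq> M'"
  shows "T \<subseteq> T'"
proof
  interpret X: tame_at T P M A by fact
  interpret Y: tame_at T' P' M' A by fact
  fix x assume x: "x \<in> T"
  have bound: "norm (x - P' x) \<le> 4 * e * norm x" if e: "0 < e" "e \<le> 1/2" for e
  proof -
    obtain \<delta> where \<delta>: "0 < \<delta>" "\<And>p q. \<lbrakk>p \<in> M' \<inter> ball A \<delta>; q \<in> M' \<inter> ball A \<delta>\<rbrakk> \<Longrightarrow>
        norm ((q - p) - P' (q - p)) \<le> e * norm (q - p)"
      using Y.secant[OF e(1)] by blast
    obtain t B where t: "0 < t" "B \<in> M" "norm (B - A) < \<delta>"
      "norm (B - A - t *\<^sub>R x) \<le> e * norm (B - A)"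
      using X.approach[OF x e(1) \<delta>(1)] by metis
    define b where "b = B - A"
    have b': "norm (b - P' b) \<le> e * norm b"
      unfolding b_def using t \<delta>(1) assms(3) X.A_in
      by (intro \<delta>(2)) (auto simp: dist_norm norm_minus_commute)
    have bt: "norm (b - t *\<^sub>R x) \<le> e * norm b" using t(4) by (simp add: b_def)
    have "e * norm b \<le> 1/2 * norm b" using e(2) by (intro mult_right_mono) auto
    then have "norm b \<le> 2 * (t * norm x)"
      using bt norm_triangle_sub[of b "t *\<^sub>R x"] t(1) by simp
    then have eb: "e * norm b \<le> e * (2 * (t * norm x))"
      using e(1) by (intro mult_left_mono) auto
    have "t *\<^sub>R (x - P' x) = (b - P' b) - ((b - t *\<^sub>R x) - P' (b - t *\<^sub>R x))"
      by (simp add: Y.P_diff linear_scale[OF Y.linear_P] scaleR_diff_right)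
    then have "norm (t *\<^sub>R (x - P' x)) \<le> norm (b - P' b) + norm ((b - t *\<^sub>R x) - P' (b - t *\<^sub>R x))"
      by (metis norm_triangle_ineq4)
    also have "\<dots> \<le> e * norm b + e * norm b"
      using b' bt Y.norm_residual_le[of "b - t *\<^sub>R x"] by linarith
    also have "\<dots> \<le> t * (4 * e * norm x)"
      using eb by (simp add: mult_ac)
    finally show ?thesis using t(1) by simp
  qed
  have "x - P' x = 0"
  proof (rule ccontr)
    assume "x - P' x \<noteq> 0"
    then have g: "0 < norm (x - P' x)" by simp
    have n: "0 < norm x + 1" using norm_ge_zero[of x] by linarith
    \<comment> \<open>Makes the residual at least \<open>8 * e * (norm x + 1)\<close>, more than the
      bound \<open>4 * e * norm x\<close> permits.\<close>
    define e where "e = min (1/2) (norm (x - P' x) / (8 * (norm x + 1)))"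
    have "0 < norm (x - P' x) / (8 * (norm x + 1))"
      using g n by (intro divide_pos_pos) auto
    then have e: "0 < e" "e \<le> 1/2" "e \<le> norm (x - P' x) / (8 * (norm x + 1))"
      unfolding e_def by linarith+
    then have "8 * (e * (norm x + 1)) \<le> norm (x - P' x)"
      using n by (simp add: pos_le_divide_eq mult_ac)
    with bound[OF e(1,2)] have "8 * (e * norm x) + 8 * e \<le> 4 * (e * norm x)"
      by (simp add: algebra_simps)
    moreover have "0 \<le> e * norm x" using e by simp
    ultimately show False using e(1) by linarith
  qed
  then show "x \<in> T'" using Y.P_in[of x] by simp
qed

text \<open>The supremum is monotone in \<open>r\<close> and bounded below, so its limit at
  \<open>0\<close> exists and is its infimum. Hence a strict bound on the limit already holds for
  the supremum at some radius.\<close>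

lemma sigma_at_bound:
  fixes M1 M2 :: "'a::euclidean_space set"
  assumes "A \<in> M1 \<inter> M2" and less: "sigma_at p M1 M2 A < c"
  shows "0 \<le> sigma_at p M1 M2 A"
    and "\<exists>r>0. \<forall>B1\<in>M1. \<forall>B2\<in>M2. norm (B1 - A) < r \<longrightarrow> norm (B2 - A) < r \<longrightarrow>
      (\<forall>t\<in>tangent_space p (M1 \<inter> M2) A. orthogonal (B1 - A) t \<and> orthogonal (B2 - A) t) \<longrightarrow>
      (B1 - A) \<bullet> (B2 - A) \<le> c * (norm (B1 - A) * norm (B2 - A))"
proof -
  define T where "T = tangent_space p (M1 \<inter> M2) A"
  define Q where "Q r = {((B1 - A) \<bullet> (B2 - A)) / (norm (B1 - A) * norm (B2 - A)) | B1 B2.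
        B1 \<in> M1 \<and> norm (B1 - A) < r \<and> (\<forall>t\<in>T. orthogonal (B1 - A) t) \<and>
        B2 \<in> M2 \<and> norm (B2 - A) < r \<and> (\<forall>t\<in>T. orthogonal (B2 - A) t)}" for r
  define f where "f r = Sup (Q r)" for r
  define \<sigma> where "\<sigma> = Inf (f ` {0<..})"
  have sigma: "sigma_at p M1 M2 A = Lim (at_right 0) f"
    unfolding sigma_at_def f_def Q_def T_def ..
  have Q_le: "x \<le> 1" if "x \<in> Q r" for x r
  proof -
    have "(u \<bullet> v) / (norm u * norm v) \<le> 1" for u v :: 'a
      using norm_cauchy_schwarz[of u v] by (intro divide_le_eq_1[THEN iffD2]) (auto simp: zero_less_mult_iff)
    then show ?thesis using that by (auto simp: Q_def)
  qed
  then have bdd: "bdd_above (Q r)" for r by (intro bdd_aboveI)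
  \<comment> \<open>The pair \<open>B1 = B2 = A\<close> has quotient \<open>0 / 0 = 0\<close>.\<close>
  have Q0: "0 \<in> Q r" if "0 < r" for r
    unfolding Q_def mem_Collect_eq
    by (intro exI[of _ A]) (use assms that in \<open>auto simp: orthogonal_def\<close>)
  have f0: "0 \<le> f r" if "0 < r" for r
    unfolding f_def using cSup_upper[OF Q0[OF that] bdd] .
  have mono: "f r \<le> f r'" if "0 < r" "r \<le> r'" for r r'
    unfolding f_def
  proof (rule cSup_subset_mono[OF _ bdd])
    show "Q r \<noteq> {}" using Q0 that by blast
    show "Q r \<subseteq> Q r'" using that unfolding Q_def by fastforce
  qed
  have bddf: "bdd_below (f ` {0<..})" using f0 by (intro bdd_belowI[of _ 0]) auto
  have "(f \<longlongrightarrow> \<sigma>) (at_right 0)"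
  proof (rule order_tendstoI)
    fix a assume "a < \<sigma>"
    then have "a < f r" if "0 < r" for r
      using cInf_lower[OF _ bddf, of "f r"] that unfolding \<sigma>_def by fastforce
    then show "\<forall>\<^sub>F r in at_right 0. a < f r"
      by (rule eventually_mono[OF eventually_at_right_less])
  next
    fix a assume "\<sigma> < a"
    then obtain r0 where r0: "0 < r0" "f r0 < a"
      unfolding \<sigma>_def by (subst (asm) cInf_less_iff) (use bddf in auto)
    then have "f r < a" if "r \<in> {0<..<r0}" for r
      using mono[of r r0] that by simp
    then show "\<forall>\<^sub>F r in at_right 0. f r < a"
      by (rule eventually_mono[OF eventually_at_right_real[OF r0(1)]])
  qed
  then have lim: "sigma_at p M1 M2 A = \<sigma>"
    unfolding sigma by (intro tendsto_Lim) auto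
  show "0 \<le> sigma_at p M1 M2 A"
    unfolding lim \<sigma>_def by (rule cInf_greatest) (use f0 in auto)
  obtain r where r: "0 < r" "f r < c"
    using less unfolding lim \<sigma>_def by (subst (asm) cInf_less_iff) (use bddf in auto)
  have "(B1 - A) \<bullet> (B2 - A) \<le> c * (norm (B1 - A) * norm (B2 - A))"
    if "B1 \<in> M1" "B2 \<in> M2" "norm (B1 - A) < r" "norm (B2 - A) < r"
      "\<forall>t\<in>T. orthogonal (B1 - A) t \<and> orthogonal (B2 - A) t" for B1 B2
  proof -
    have "((B1 - A) \<bullet> (B2 - A)) / (norm (B1 - A) * norm (B2 - A)) \<in> Q r"
      unfolding Q_def using that by blast
    from cSup_upper[OF this bdd]
    have "((B1 - A) \<bullet> (B2 - A)) / (norm (B1 - A) * norm (B2 - A)) \<le> c"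
      using r(2) by (simp add: f_def)
    then show ?thesis
      by (cases "norm (B1 - A) * norm (B2 - A) = 0")
        (auto simp: divide_le_eq zero_less_mult_iff)
  qed
  then show "\<exists>r>0. \<forall>B1\<in>M1. \<forall>B2\<in>M2. norm (B1 - A) < r \<longrightarrow> norm (B2 - A) < r \<longrightarrow>
      (\<forall>t\<in>tangent_space p (M1 \<inter> M2) A. orthogonal (B1 - A) t \<and> orthogonal (B2 - A) t) \<longrightarrow>
      (B1 - A) \<bullet> (B2 - A) \<le> c * (norm (B1 - A) * norm (B2 - A))"
    using r(1) unfolding T_def by blast
qed

text \<open>Transfers the angle bound from points to tangent vectors. Choose \<open>B1\<close>,
  \<open>B2\<close> whose differences to \<open>A\<close> project exactly to positive multiples of
  \<open>u1\<close>, \<open>u2\<close>. As \<open>T\<close> lies in both tangent spaces, these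
  differences are orthogonal to \<open>T\<close>, so the bound for points applies; the gap between
  \<open>c1\<close> and \<open>c2\<close> absorbs the errors.\<close>

lemma tangent_angle:
  assumes "tame_at T1 P1 M1 A" "tame_at T2 P2 M2 A" "T \<subseteq> T1" "T \<subseteq> T2"
    and c: "0 \<le> c1" "c1 < c2" "c2 \<le> 1" and "0 < r"
    and angle: "\<And>B1 B2. \<lbrakk>B1 \<in> M1; B2 \<in> M2; norm (B1 - A) < r; norm (B2 - A) < r;
        \<And>t. t \<in> T \<Longrightarrow> (B1 - A) \<bullet> t = 0; \<And>t. t \<in> T \<Longrightarrow> (B2 - A) \<bullet> t = 0\<rbrakk> \<Longrightarrow>
      (B1 - A) \<bullet> (B2 - A) \<le> c1 * (norm (B1 - A) * norm (B2 - A))"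
    and u1: "u1 \<in> T1" "\<And>t. t \<in> T \<Longrightarrow> u1 \<bullet> t = 0"
    and u2: "u2 \<in> T2" "\<And>t. t \<in> T \<Longrightarrow> u2 \<bullet> t = 0"
  shows "u1 \<bullet> u2 \<le> c2 * (norm u1 * norm u2)"
proof -
  interpret X1: tame_at T1 P1 M1 A by fact
  interpret X2: tame_at T2 P2 M2 A by fact
  \<comment> \<open>Chosen so that \<open>c1 + 2 * e = c2 - 2 * e\<close>, which is at most
    \<open>c2 * (1 - e)\<^sup>2\<close> because \<open>c2 \<le> 1\<close>.\<close>
  define e where "e = (c2 - c1) / 4"
  have e: "0 < e" "e < 1" using c by (auto simp: e_def)
  obtain t1 B1 where B1: "0 < t1" "B1 \<in> M1" "norm (B1 - A) < r" "P1 (B1 - A) = t1 *\<^sub>R u1"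
    "norm (B1 - A - t1 *\<^sub>R u1) \<le> e * norm (B1 - A)"
    using X1.approach[OF u1(1) e(1) \<open>0 < r\<close>] by metis
  obtain t2 B2 where B2: "0 < t2" "B2 \<in> M2" "norm (B2 - A) < r" "P2 (B2 - A) = t2 *\<^sub>R u2"
    "norm (B2 - A - t2 *\<^sub>R u2) \<le> e * norm (B2 - A)"
    using X2.approach[OF u2(1) e(1) \<open>0 < r\<close>] by metis
  define b1 b2 a1 a2 where "b1 = B1 - A" and "b2 = B2 - A" and "a1 = t1 *\<^sub>R u1" and "a2 = t2 *\<^sub>R u2"
  have "(B1 - A) \<bullet> t = 0" if "t \<in> T" for t
    using X1.P_inner[of t "B1 - A"] B1(4) u1(2)[OF that] that assms(3) by auto
  moreover have "(B2 - A) \<bullet> t = 0" if "t \<in> T" for t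
    using X2.P_inner[of t "B2 - A"] B2(4) u2(2)[OF that] that assms(4) by auto
  ultimately have b: "b1 \<bullet> b2 \<le> c1 * (norm b1 * norm b2)"
    unfolding b1_def b2_def using B1 B2 by (intro angle) auto
  have a1: "norm (b1 - a1) \<le> e * norm b1" "norm a1 \<le> norm b1"
    using B1 X1.norm_P_le[of b1] by (auto simp: b1_def a1_def)
  have a2: "norm (b2 - a2) \<le> e * norm b2" "norm a2 \<le> norm b2"
    using B2 X2.norm_P_le[of b2] by (auto simp: b2_def a2_def)
  have "- (b1 \<bullet> (b2 - a2)) \<le> norm b1 * norm (b2 - a2)"
    using Cauchy_Schwarz_ineq2[of b1 "b2 - a2"] by linarith
  also have "\<dots> \<le> norm b1 * (e * norm b2)"
    using a2 by (intro mult_left_mono) auto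
  finally have 1: "- (b1 \<bullet> (b2 - a2)) \<le> e * (norm b1 * norm b2)" by (simp add: mult_ac)
  have "- ((b1 - a1) \<bullet> a2) \<le> norm (b1 - a1) * norm a2"
    using Cauchy_Schwarz_ineq2[of "b1 - a1" a2] by linarith
  also have "\<dots> \<le> (e * norm b1) * norm b2"
    using a1 a2 e by (intro mult_mono) auto
  finally have 2: "- ((b1 - a1) \<bullet> a2) \<le> e * (norm b1 * norm b2)" by (simp add: mult_ac)
  have "a1 \<bullet> a2 = b1 \<bullet> b2 - b1 \<bullet> (b2 - a2) - (b1 - a1) \<bullet> a2"
    by (simp add: inner_diff_left inner_diff_right)
  also have "\<dots> \<le> (c1 + 2 * e) * (norm b1 * norm b2)"
    using b 1 2 by (simp add: distrib_right)
  also have "\<dots> \<le> (c2 * (1 - e)\<^sup>2) * (norm b1 * norm b2)"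
  proof (rule mult_right_mono)
    have "2 * e * c2 \<le> 2 * e" "0 \<le> c2 * e\<^sup>2"
      using c e by (auto simp: mult_left_le)
    moreover have "c2 * (1 - e)\<^sup>2 = c2 - 2 * e * c2 + c2 * e\<^sup>2"
      by (simp add: power2_eq_square algebra_simps)
    moreover have "4 * e = c2 - c1" by (simp add: e_def)
    ultimately show "c1 + 2 * e \<le> c2 * (1 - e)\<^sup>2" by linarith
  qed simp
  also have "\<dots> = c2 * (((1 - e) * norm b1) * ((1 - e) * norm b2))"
    by (simp add: power2_eq_square mult_ac)
  also have "\<dots> \<le> c2 * (norm a1 * norm a2)"
  proof (intro mult_left_mono mult_mono)
    show "(1 - e) * norm b1 \<le> norm a1"
      using a1(1) norm_triangle_sub[of b1 a1] by (simp add: algebra_simps)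
    show "(1 - e) * norm b2 \<le> norm a2"
      using a2(1) norm_triangle_sub[of b2 a2] by (simp add: algebra_simps)
  qed (use c e in auto)
  finally have "(t1 * t2) * (u1 \<bullet> u2) \<le> (t1 * t2) * (c2 * (norm u1 * norm u2))"
    using B1(1) B2(1) by (simp add: a1_def a2_def mult_ac)
  then show ?thesis using B1(1) B2(1) by simp
qed

text \<open>Here \<open>p\<close> and \<open>q\<close> stand for the projections of \<open>X\<close>
  and \<open>Y\<close> onto the intersection. Split \<open>u = X - p\<close> into \<open>w\<close>,
  in \<open>T1\<close> and orthogonal to \<open>T\<close>, and a remainder of size
  \<open>2 * e\<close>. As \<open>P2 w\<close> is also orthogonal to \<open>T\<close>, the angle
  bound applied to \<open>w \<bullet> P2 w\<close> gives the factor \<open>c\<close>; the error of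
  \<open>Y\<close> adds \<open>3 * e\<close>. For the drift of \<open>p\<close>, the component of
  \<open>Y - p\<close> along \<open>T\<close> is only that of \<open>u\<close> plus an
  error.\<close>

lemma alternating_step:
  assumes "orth_projector T P" "orth_projector T1 P1" "orth_projector T2 P2" "T \<subseteq> T1" "T \<subseteq> T2"
    and angle: "\<forall>u1\<in>T1. \<forall>u2\<in>T2. (\<forall>t\<in>T. u1 \<bullet> t = 0 \<and> u2 \<bullet> t = 0) \<longrightarrow>
      u1 \<bullet> u2 \<le> c * (norm u1 * norm u2)"
    and "0 \<le> c"
    and normal: "norm (P (X - p)) \<le> e * norm (X - p)"
    and secant: "norm ((X - p) - P1 (X - p)) \<le> e * norm (X - p)"
    and Y: "norm (Y - p - P2 (X - p)) \<le> 3 * e * norm (X - p)"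
    and q: "norm (q - p - P (Y - p)) \<le> 3 * e * norm (Y - p)"
  shows "norm (Y - p) \<le> (c + 5 * e) * norm (X - p)"
    and "norm (q - p) \<le> 3 * e * norm (Y - p) + 4 * e * norm (X - p)"
proof -
  interpret X: orth_projector T P by fact
  interpret X1: orth_projector T1 P1 by fact
  interpret X2: orth_projector T2 P2 by fact
  define u where "u = X - p"
  define w where "w = P1 u - P u"
  have PP1: "P (P1 x) = P x" for x
  proof (rule X.P_eqI[OF X.P_in, symmetric, THEN sym])
    fix t assume t: "t \<in> T"
    then have "P1 x \<bullet> t = x \<bullet> t" "P x \<bullet> t = x \<bullet> t"
      using X.P_inner X1.P_inner assms(4) by auto
    then show "(P1 x - P x) \<bullet> t = 0" by (simp add: inner_diff_left)
  qed
  have PP2: "P (P2 x) = P x" for x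
  proof (rule X.P_eqI[OF X.P_in, symmetric, THEN sym])
    fix t assume t: "t \<in> T"
    then have "P2 x \<bullet> t = x \<bullet> t" "P x \<bullet> t = x \<bullet> t"
      using X.P_inner X2.P_inner assms(5) by auto
    then show "(P2 x - P x) \<bullet> t = 0" by (simp add: inner_diff_left)
  qed
  have Pw: "P w = 0" by (simp add: w_def X.P_diff PP1 X.P_idem)
  have orth: "y \<bullet> t = 0" if "P y = 0" "t \<in> T" for y t
    using X.P_inner[OF that(2), of y] that(1) by simp
  have w1: "w \<in> T1"
    unfolding w_def using X1.P_in X.P_in assms(4) X1.subspace_T by (blast intro: subspace_diff)
  have "w = P1 u - P (P1 u)" by (simp add: w_def PP1)
  then have wu: "norm w \<le> norm u"
    using X.norm_residual_le[of "P1 u"] X1.norm_P_le[of u] by simp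
  have "norm (P2 w) * norm (P2 w) = w \<bullet> P2 w"
    using X2.P_inner[OF X2.P_in, of w w] by (simp add: power2_norm_eq_inner flip: power2_eq_square)
  also have "\<dots> \<le> c * (norm w * norm (P2 w))"
    using angle w1 X2.P_in orth[OF Pw] orth[of "P2 w"] by (simp add: PP2 Pw)
  also have "\<dots> \<le> (c * norm u) * norm (P2 w)"
    using wu \<open>0 \<le> c\<close> by (simp add: mult.assoc mult_left_mono mult_right_mono)
  finally have 1: "norm (P2 w) \<le> c * norm u"
    using \<open>0 \<le> c\<close> by (cases "P2 w = 0") auto
  have uw: "u - w = (u - P1 u) + P u" by (simp add: w_def)
  have "norm (u - w) \<le> e * norm u + e * norm u"
    unfolding uw using norm_triangle_ineq[of "u - P1 u" "P u"] normal secant by (simp add: u_def)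
  then have 2: "norm (P2 (u - w)) \<le> 2 * e * norm u"
    using X2.norm_P_le[of "u - w"] by simp
  define z where "z = Y - p - P2 u"
  have z: "norm z \<le> 3 * e * norm u" using Y by (simp add: z_def u_def)
  have "Y - p = P2 w + P2 (u - w) + z"
    by (simp add: z_def X2.P_diff)
  then have "norm (Y - p) \<le> norm (P2 w) + norm (P2 (u - w)) + norm z"
    using norm_triangle_ineq[of "P2 w + P2 (u - w)" z] norm_triangle_ineq[of "P2 w" "P2 (u - w)"]
    by simp
  with 1 2 z show "norm (Y - p) \<le> (c + 5 * e) * norm (X - p)"
    by (simp add: u_def algebra_simps)
  have "P (Y - p) = P z + P u"
    by (simp add: z_def X.P_diff PP2)
  then have "norm (P (Y - p)) \<le> 4 * e * norm u"
    using norm_triangle_ineq[of "P z" "P u"] X.norm_P_le[of z] z normal by (simp add: u_def)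
  moreover have "norm (q - p) \<le> norm (q - p - P (Y - p)) + norm (P (Y - p))"
    using norm_triangle_ineq[of "q - p - P (Y - p)" "P (Y - p)"] by simp
  ultimately show "norm (q - p) \<le> 3 * e * norm (Y - p) + 4 * e * norm (X - p)"
    using q by (simp add: u_def)
qed

text \<open>The argument is run in the very chart that the choice in \<open>tangent_space\<close>
  picks, so the two tangent spaces coincide literally.\<close>

lemma tame_at_exists:
  fixes M :: "'a::euclidean_space set"
  assumes "closed M" "locally_manifold 2 m M A"
  obtains P where "tame_at (tangent_space 2 M A) P M A"
proof -
  have "\<exists>T m V r \<phi>. local_param 2 m M A V r \<phi> \<and>
      T = frechet_derivative \<phi> (at 0 within V \<inter> ball 0 r) ` V"
    using assms(2) unfolding locally_manifold_def by blast
  from someI_ex[OF this] obtain m V r \<phi> where par: "local_param 2 m M A V r \<phi>"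
    and T: "tangent_space 2 M A = frechet_derivative \<phi> (at 0 within V \<inter> ball 0 r) ` V"
    unfolding tangent_space_def by blast
  obtain \<rho> D L l where chart: "C11_chart M A V \<rho> \<phi> D L l"
    and D: "D 0 ` V = frechet_derivative \<phi> (at 0 within V \<inter> ball 0 r) ` V"
    using C11_chart_exists[OF par] by blast
  interpret C11_chart M A V \<rho> \<phi> D L l by fact
  have "subspace (D 0 ` V)"
    using linear_D[OF zero_dom] subspace_V by (rule linear_subspace_image)
  then obtain P where "orth_projector (D 0 ` V) P"
    using orth_projector_exists by blast
  then have "tame_at (D 0 ` V) P M A"
    using assms(1) by (rule tame)
  then show ?thesis
    using that by (simp only: T D)
qed

section \<open>Convergence of the alternating projections\<close>

text \<open>The increments telescope and are dominated by a geometric series, whose tail from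
  \<open>k\<close> on gives the rate.\<close>

lemma geometric_increments_limit:
  fixes p :: "nat \<Rightarrow> 'a::banach"
  assumes inc: "\<And>k. norm (p (Suc k) - p k) \<le> a * c ^ k" and c: "0 \<le> c" "c < 1"
  obtains l where "p \<longlonglongrightarrow> l" "\<And>k. norm (l - p k) \<le> a * c ^ k / (1 - c)"
proof -
  have sg: "summable (\<lambda>n. a * c ^ n)"
    using c by (intro summable_mult summable_geometric) auto
  have "summable (\<lambda>n. p (Suc n) - p n)"
    by (rule summable_comparison_test'[OF sg inc])
  then obtain S where "(\<lambda>n. \<Sum>k<n. p (Suc k) - p k) \<longlonglongrightarrow> S"
    using summable_LIMSEQ by blast
  then have "(\<lambda>n. p n - p 0) \<longlonglongrightarrow> S"
    by (simp add: sum_lessThan_telescope)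
  then have lim: "p \<longlonglongrightarrow> S + p 0"
    using tendsto_add[OF _ tendsto_const, of "\<lambda>n. p n - p 0" S sequentially "p 0"] by simp
  have "norm (S + p 0 - p k) \<le> a * c ^ k / (1 - c)" for k
  proof -
    have "(\<lambda>n. p (n + k)) \<longlonglongrightarrow> S + p 0"
      using lim by (rule LIMSEQ_ignore_initial_segment)
    from telescope_sums[OF this]
    have s: "(\<lambda>n. p (Suc (n + k)) - p (n + k)) sums (S + p 0 - p k)" by simp
    have g: "(\<lambda>n. a * c ^ k * c ^ n) sums (a * c ^ k * (1 / (1 - c)))"
      using c by (intro sums_mult geometric_sums) auto
    have "norm (\<Sum>n. p (Suc (n + k)) - p (n + k)) \<le> (\<Sum>n. a * c ^ k * c ^ n)"
      using inc[of "_ + k"] sums_summable[OF g] by (intro norm_suminf_le) (simp_all add: power_add mult_ac)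
    then show ?thesis
      using sums_unique[OF s] sums_unique[OF g] by simp
  qed
  then show ?thesis using that lim by blast
qed

text \<open>The step estimate is available only near \<open>A\<close>, so one induction carries both
  bounds: \<open>b k\<close> approaches \<open>p k\<close> like \<open>c ^ k\<close>, and
  \<open>p k\<close> drifts from \<open>q\<close> by at most a partial geometric sum. Together they
  keep \<open>b k\<close> in the region where the next step is allowed.\<close>

lemma alternating_sequence_converges:
  fixes A B q :: "'a::banach" and b p :: "nat \<Rightarrow> 'a"
  assumes e: "0 < e" "3 * e \<le> 1" "24 * e \<le> 1 - c" and c: "0 \<le> c" "c < 1"
    and d: "norm (B - q) \<le> norm (B - A)" and s: "norm (B - A) < s"
    and init: "norm (b 0 - p 0) \<le> (1 + 3 * e) * norm (B - q)" "norm (p 0 - q) \<le> 10 * e * norm (B - q)"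
    and step: "\<forall>k. norm (b k - A) < 5 * s \<longrightarrow> norm (b (Suc k) - p (Suc k)) \<le> c * norm (b k - p k) \<and>
      norm (p (Suc k) - p k) \<le> 7 * e * norm (b k - p k)"
  obtains l where "p \<longlonglongrightarrow> l" "b \<longlonglongrightarrow> l" "\<And>k. norm (b k - A) < 5 * s"
    "norm (l - q) \<le> 24 * e / (1 - c) * norm (B - q)"
    "\<And>k. norm (l - b k) \<le> (1 + 17 * e / (1 - c)) * c ^ k * norm (B - q)"
proof -
  define \<delta> where "\<delta> = norm (B - q)"
  \<comment> \<open>The sum of \<open>c ^ i\<close> over \<open>i < k\<close>, which measures the
    accumulated drift.\<close>
  define G where "G k = (1 - c ^ k) / (1 - c)" for k
  have G: "G k \<le> 1 / (1 - c)" "G (Suc k) = G k + c ^ k" for k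
  proof -
    show "G k \<le> 1 / (1 - c)"
      unfolding G_def using c by (intro divide_right_mono) auto
    show "G (Suc k) = G k + c ^ k"
      using c by (simp add: G_def field_simps)
  qed
  have \<delta>0: "0 \<le> \<delta>" by (simp add: \<delta>_def)
  have e14: "7 * e * ((1 + 3 * e) * x) \<le> 14 * e * x" if "0 \<le> x" for x
    using mult_right_mono[of "1 + 3 * e" 2 "7 * e * x"] e that by (simp add: mult_ac)
  \<comment> \<open>The radius is \<open>2 + 1 + 1 + 1\<close> times \<open>s\<close>: from
    \<open>b k\<close> to \<open>p k\<close>, to \<open>q\<close>, to \<open>B\<close> and to
    \<open>A\<close>.\<close>
  have near: "norm (b k - A) < 5 * s"
    if 1: "norm (b k - p k) \<le> (1 + 3 * e) * c ^ k * \<delta>" and 2: "norm (p k - q) \<le> (10 * e + 14 * e * G k) * \<delta>" for k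
  proof -
    have "(1 + 3 * e) * c ^ k * \<delta> \<le> 2 * 1 * \<delta>"
      using e c \<delta>0 by (intro mult_right_mono mult_mono) (auto simp: power_le_one)
    moreover have "(10 * e + 14 * e * G k) * \<delta> \<le> 1 * \<delta>"
    proof (intro mult_right_mono \<delta>0)
      have "14 * e * G k \<le> 14 * e * (1 / (1 - c))"
        using G(1) e by (intro mult_left_mono) auto
      moreover have "10 * e \<le> 10 * e * (1 / (1 - c))"
        using e c by (simp add: field_simps)
      moreover have "24 * e * (1 / (1 - c)) \<le> 1"
        using e c by (simp add: field_simps)
      ultimately show "10 * e + 14 * e * G k \<le> 1" by linarith
    qed
    moreover have "norm (b k - A) \<le> norm (b k - p k) + norm (p k - q) + norm (B - q) + norm (B - A)"
      using norm_triangle_ineq[of "b k - p k" "p k - A"] norm_triangle_ineq[of "p k - q" "q - A"]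
        norm_triangle_ineq4[of "B - A" "B - q"] by simp
    ultimately show ?thesis
      using 1 2 d s by (simp add: \<delta>_def)
  qed
  have inv: "norm (b k - p k) \<le> (1 + 3 * e) * c ^ k * \<delta> \<and> norm (p k - q) \<le> (10 * e + 14 * e * G k) * \<delta>" for k
  proof (induction k)
    case 0
    then show ?case using init by (simp add: G_def \<delta>_def)
  next
    case (Suc k)
    from step near Suc
    have st: "norm (b (Suc k) - p (Suc k)) \<le> c * norm (b k - p k)"
      "norm (p (Suc k) - p k) \<le> 7 * e * norm (b k - p k)" by auto
    have "c * norm (b k - p k) \<le> c * ((1 + 3 * e) * c ^ k * \<delta>)"
      using Suc c by (intro mult_left_mono) auto
    then have 1: "norm (b (Suc k) - p (Suc k)) \<le> (1 + 3 * e) * c ^ Suc k * \<delta>"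
      using st(1) by (simp add: mult_ac)
    have "7 * e * norm (b k - p k) \<le> 7 * e * ((1 + 3 * e) * (c ^ k * \<delta>))"
      using Suc e by (intro mult_left_mono) (auto simp: mult.assoc)
    also have "\<dots> \<le> 14 * e * (c ^ k * \<delta>)"
      using c \<delta>0 by (intro e14) auto
    finally have "norm (p (Suc k) - p k) \<le> 14 * e * c ^ k * \<delta>"
      using st(2) by (simp add: mult_ac)
    then have "norm (p (Suc k) - q) \<le> 14 * e * c ^ k * \<delta> + (10 * e + 14 * e * G k) * \<delta>"
      using norm_triangle_ineq[of "p (Suc k) - p k" "p k - q"] Suc by simp
    also have "\<dots> = (10 * e + 14 * e * G (Suc k)) * \<delta>"
      by (simp add: G(2) algebra_simps)
    finally show ?case using 1 by blast
  qed
  have nearA: "norm (b k - A) < 5 * s" for k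
    using near inv by blast
  have inc: "norm (p (Suc k) - p k) \<le> 14 * e * \<delta> * c ^ k" for k
  proof -
    have "norm (p (Suc k) - p k) \<le> 7 * e * norm (b k - p k)"
      using step nearA by blast
    also have "\<dots> \<le> 7 * e * ((1 + 3 * e) * (c ^ k * \<delta>))"
      using inv e by (intro mult_left_mono) (auto simp: mult.assoc)
    also have "\<dots> \<le> 14 * e * (c ^ k * \<delta>)"
      using c \<delta>0 by (intro e14) auto
    finally show ?thesis by (simp add: mult_ac)
  qed
  obtain l where l: "p \<longlonglongrightarrow> l" "\<And>k. norm (l - p k) \<le> 14 * e * \<delta> * c ^ k / (1 - c)"
    using geometric_increments_limit[OF inc c] by blast
  have bp: "norm (b k - p k) \<le> c ^ k * ((1 + 3 * e) * \<delta>)" for k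
    using inv[of k] by (simp add: mult_ac)
  have "(\<lambda>k. c ^ k * ((1 + 3 * e) * \<delta>)) \<longlonglongrightarrow> 0"
    using c by (intro tendsto_mult_left_zero LIMSEQ_power_zero) auto
  then have "(\<lambda>k. b k - p k) \<longlonglongrightarrow> 0"
    by (rule Lim_null_comparison[OF always_eventually[OF allI[OF bp]]])
  from tendsto_add[OF this l(1)] have b: "b \<longlonglongrightarrow> l" by simp
  have "norm (l - q) \<le> norm (l - p 0) + norm (p 0 - q)"
    using norm_triangle_ineq[of "l - p 0" "p 0 - q"] by simp
  also have "\<dots> \<le> 14 * e * \<delta> / (1 - c) + 10 * e * \<delta>"
    using l(2)[of 0] init(2) by (simp add: \<delta>_def)
  also have "10 * e * \<delta> \<le> 10 * e * \<delta> / (1 - c)"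
    using e c \<delta>0 mult_right_mono[of 0 c "10 * e * \<delta>"] by (simp add: field_simps)
  finally have lq: "norm (l - q) \<le> 24 * e / (1 - c) * \<delta>"
    by (simp add: add_divide_distrib[symmetric] mult_ac)
  have lb: "norm (l - b k) \<le> (1 + 17 * e / (1 - c)) * c ^ k * \<delta>" for k
  proof -
    have "norm (l - b k) \<le> norm (l - p k) + norm (b k - p k)"
      using norm_triangle_ineq4[of "l - p k" "b k - p k"] by simp
    also have "\<dots> \<le> 14 * e * \<delta> * c ^ k / (1 - c) + (1 + 3 * e) * c ^ k * \<delta>"
      using l(2) inv by (intro add_mono) auto
    \<comment> \<open>Enlarging \<open>3 * e\<close> to \<open>3 * e / (1 - c)\<close> merges the
      two error terms into \<open>17 * e / (1 - c)\<close>.\<close>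
    also have "\<dots> = (14 * e / (1 - c) + 3 * e + 1) * (c ^ k * \<delta>)"
      by (simp add: algebra_simps)
    also have "\<dots> \<le> (14 * e / (1 - c) + 3 * e / (1 - c) + 1) * (c ^ k * \<delta>)"
      using e c \<delta>0 by (intro mult_right_mono add_mono order_refl) (auto simp: field_simps)
    finally show ?thesis by (simp add: add_divide_distrib[symmetric] mult_ac add_ac)
  qed
  show ?thesis
    using that[OF l(1) b nearA] lq lb by (simp add: \<delta>_def)
qed

lemma closest_point_minimal:
  assumes "closed S" "A \<in> S"
  shows "closest_point S B \<in> S" "\<forall>p\<in>S. dist B (closest_point S B) \<le> dist B p"
  using closest_point_exists[OF assms(1)] assms(2) by auto

text \<open>For \<open>B\<close> in the intersection all distances vanish, so strict inequalities
  are claimed only for other \<open>B\<close>. At \<open>k = 0\<close> the factor is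
  \<open>1 + \<epsilon>\<close>: for two linear subspaces and \<open>B\<close> in the first but not
  in the second, the starting point is \<open>B\<close> and the limit is its projection onto the
  intersection, which gives equality with factor \<open>1\<close>.\<close>

theorem theorem6p1:
  fixes M1 M2 :: "'a::euclidean_space set" and A :: 'a and \<epsilon> c :: real
  assumes "closed M1" and "closed M2"
    and "A \<in> M1 \<inter> M2" and "nontangential 2 M1 M2 A"
    and "\<epsilon> > 0" and "c < 1" and "sigma_at 2 M1 M2 A < c"
  shows "\<exists>s>0. \<forall>B. norm (B - A) < s \<longrightarrow>
    proj_defined (M1 \<inter> M2) B \<and> proj_defined M1 B \<and>
    (\<forall>k. proj_defined (if even k then M2 else M1) (alt_proj M1 M2 B k)) \<and>
    (\<exists>Binf \<in> M1 \<inter> M2.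
      alt_proj M1 M2 B \<longlonglongrightarrow> Binf \<and>
      (B \<in> M1 \<inter> M2 \<longrightarrow> Binf = B \<and> (\<forall>k. alt_proj M1 M2 B k = B)) \<and>
      (B \<notin> M1 \<inter> M2 \<longrightarrow>
        norm (Binf - closest_point (M1 \<inter> M2) B) < \<epsilon> * norm (B - closest_point (M1 \<inter> M2) B) \<and>
        norm (Binf - alt_proj M1 M2 B 0) < (1 + \<epsilon>) * norm (B - closest_point (M1 \<inter> M2) B) \<and>
        (\<forall>k\<ge>1. norm (Binf - alt_proj M1 M2 B k)
              < c ^ k * norm (B - closest_point (M1 \<inter> M2) B))))"
proof -

  \<comment> \<open>Tangent spaces at \<open>A\<close> and their angle\<close>
  define M where "M = M1 \<inter> M2"
  have closedM: "closed M" and AM: "A \<in> M" using assms by (auto simp: M_def)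
  define T where "T = tangent_space 2 M A"
  define T1 where "T1 = tangent_space 2 M1 A"
  define T2 where "T2 = tangent_space 2 M2 A"
  obtain m1 m2 m where "locally_manifold 2 m1 M1 A" "locally_manifold 2 m2 M2 A" "locally_manifold 2 m M A"
    using assms(4) unfolding nontangential_def regular_point_def M_def by blast
  then obtain P1 P2 P where t1: "tame_at T1 P1 M1 A" and t2: "tame_at T2 P2 M2 A" and t: "tame_at T P M A"
    using tame_at_exists assms(1,2) closedM unfolding T_def T1_def T2_def by metis
  interpret X1: tame_at T1 P1 M1 A by fact
  interpret X2: tame_at T2 P2 M2 A by fact
  interpret X: tame_at T P M A by fact
  have TT: "T \<subseteq> T1" "T \<subseteq> T2"
    using tangent_mono[OF t t1] tangent_mono[OF t t2] by (auto simp: M_def)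
  define \<sigma> where "\<sigma> = sigma_at 2 M1 M2 A"
  have \<sigma>: "0 \<le> \<sigma>" "\<sigma> < c"
    using sigma_at_bound(1)[OF assms(3,7)] assms(7) by (auto simp: \<sigma>_def)
  \<comment> \<open>Three levels between \<open>\<sigma>\<close> and \<open>c\<close>:
    \<open>c1\<close> bounds the angle between points, \<open>c2\<close> between tangent vectors,
    and \<open>c3\<close> is the contraction factor of one step.\<close>
  define c1 c2 c3 where "c1 = \<sigma> + (c - \<sigma>) / 4" and "c2 = \<sigma> + (c - \<sigma>) / 2" and "c3 = \<sigma> + 3 * (c - \<sigma>) / 4"
  have cs: "0 < c1" "\<sigma> < c1" "c1 < c2" "c2 < c3" "c3 < c" "c3 < 1"
    using \<sigma> assms(6) by (auto simp: c1_def c2_def c3_def field_simps)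
  obtain r where "r > 0" and r: "\<forall>B1\<in>M1. \<forall>B2\<in>M2. norm (B1 - A) < r \<longrightarrow> norm (B2 - A) < r \<longrightarrow>
      (\<forall>t\<in>T. orthogonal (B1 - A) t \<and> orthogonal (B2 - A) t) \<longrightarrow>
      (B1 - A) \<bullet> (B2 - A) \<le> c1 * (norm (B1 - A) * norm (B2 - A))"
    using sigma_at_bound(2)[OF assms(3) cs(2)[unfolded \<sigma>_def]] unfolding T_def M_def by blast
  have angle: "\<forall>u1\<in>T1. \<forall>u2\<in>T2. (\<forall>t\<in>T. u1 \<bullet> t = 0 \<and> u2 \<bullet> t = 0) \<longrightarrow>
      u1 \<bullet> u2 \<le> c2 * (norm u1 * norm u2)"
  proof (intro ballI impI)
    fix u1 u2 assume u: "u1 \<in> T1" "u2 \<in> T2" "\<forall>t\<in>T. u1 \<bullet> t = 0 \<and> u2 \<bullet> t = 0"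
    show "u1 \<bullet> u2 \<le> c2 * (norm u1 * norm u2)"
    proof (rule tangent_angle[OF t1 t2 TT _ cs(3) _ \<open>r > 0\<close> _ u(1) _ u(2)])
      show "(B1 - A) \<bullet> (B2 - A) \<le> c1 * (norm (B1 - A) * norm (B2 - A))"
        if "B1 \<in> M1" "B2 \<in> M2" "norm (B1 - A) < r" "norm (B2 - A) < r"
          "\<And>t. t \<in> T \<Longrightarrow> (B1 - A) \<bullet> t = 0" "\<And>t. t \<in> T \<Longrightarrow> (B2 - A) \<bullet> t = 0" for B1 B2
        using r that by (simp add: orthogonal_def)
    qed (use cs u(3) in auto)
  qed
  then have angle': "\<forall>u1\<in>T2. \<forall>u2\<in>T1. (\<forall>t\<in>T. u1 \<bullet> t = 0 \<and> u2 \<bullet> t = 0) \<longrightarrow>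
      u1 \<bullet> u2 \<le> c2 * (norm u1 * norm u2)"
    by (metis inner_commute mult.commute)
  have c2: "0 \<le> c2" using cs by simp

  \<comment> \<open>The entries give, in order: \<open>1 + 3 * e \<le> 2\<close>; contraction by
    \<open>c3\<close>; the deviation bound with \<open>\<epsilon>\<close>; iterates that stay near
    \<open>A\<close>; and room between \<open>c3\<close> and \<open>c\<close> for the rate. Using
    \<open>25\<close> and \<open>18\<close> where \<open>24\<close> and \<open>17\<close> occur
    later makes those bounds strict.\<close>
  define e where "e = Min {1/3, (c3 - c2) / 5, \<epsilon> * (1 - c3) / 25, (1 - c3) / 24, (c - c3) * (1 - c3) / 18}"
  have "0 < e"
    unfolding e_def using cs assms(5) by (subst Min_gr_iff) auto
  moreover have "e \<le> 1/3" "e \<le> (c3 - c2) / 5" "e \<le> \<epsilon> * (1 - c3) / 25" "e \<le> (1 - c3) / 24"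
    "e \<le> (c - c3) * (1 - c3) / 18"
    unfolding e_def by (intro Min_le; simp)+
  ultimately have e: "0 < e" "3 * e \<le> 1" "c2 + 5 * e \<le> c3" "25 * e \<le> \<epsilon> * (1 - c3)" "24 * e \<le> 1 - c3"
    "18 * e \<le> (c - c3) * (1 - c3)" by auto

  \<comment> \<open>A common neighbourhood for all local estimates\<close>
  obtain d1 where d1: "0 < d1" "\<And>B p. \<lbrakk>B \<in> ball A d1; p \<in> M1 \<inter> ball A d1\<rbrakk> \<Longrightarrow>
      norm (closest_point M1 B - p - P1 (B - p)) \<le> 3 * e * norm (B - p)"
    using X1.projection_approx[OF e(1)] by blast
  obtain d2 where d2: "0 < d2" "\<And>B p. \<lbrakk>B \<in> ball A d2; p \<in> M2 \<inter> ball A d2\<rbrakk> \<Longrightarrow>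
      norm (closest_point M2 B - p - P2 (B - p)) \<le> 3 * e * norm (B - p)"
    using X2.projection_approx[OF e(1)] by blast
  obtain d3 where d3: "0 < d3" "\<And>B p. \<lbrakk>B \<in> ball A d3; p \<in> M \<inter> ball A d3\<rbrakk> \<Longrightarrow>
      norm (closest_point M B - p - P (B - p)) \<le> 3 * e * norm (B - p)"
    using X.projection_approx[OF e(1)] by blast
  obtain d4 where d4: "0 < d4" "\<And>p q. \<lbrakk>p \<in> M1 \<inter> ball A d4; q \<in> M1 \<inter> ball A d4\<rbrakk> \<Longrightarrow>
      norm ((q - p) - P1 (q - p)) \<le> e * norm (q - p)"
    using X1.secant[OF e(1)] by blast
  obtain d5 where d5: "0 < d5" "\<And>p q. \<lbrakk>p \<in> M2 \<inter> ball A d5; q \<in> M2 \<inter> ball A d5\<rbrakk> \<Longrightarrow>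
      norm ((q - p) - P2 (q - p)) \<le> e * norm (q - p)"
    using X2.secant[OF e(1)] by blast
  obtain d6 where d6: "0 < d6" "\<And>B q. \<lbrakk>B \<in> ball A d6; q \<in> M; \<forall>p\<in>M. dist B q \<le> dist B p\<rbrakk> \<Longrightarrow>
      norm (P (B - q)) \<le> e * norm (B - q)"
    using X.normal[OF e(1)] by blast
  obtain d7 where d7: "0 < d7" "\<And>B. B \<in> ball A d7 \<Longrightarrow> proj_defined M1 B"
    using X1.unique by blast
  obtain d8 where d8: "0 < d8" "\<And>B. B \<in> ball A d8 \<Longrightarrow> proj_defined M2 B"
    using X2.unique by blast
  obtain d9 where d9: "0 < d9" "\<And>B. B \<in> ball A d9 \<Longrightarrow> proj_defined M B"
    using X.unique by blast
  define \<delta> where "\<delta> = Min {d1, d2, d3, d4, d5, d6, d7, d8, d9}"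
  have "0 < \<delta>"
    unfolding \<delta>_def using d1 d2 d3 d4 d5 d6 d7 d8 d9 by (subst Min_gr_iff) auto
  have le: "\<delta> \<le> d1" "\<delta> \<le> d2" "\<delta> \<le> d3" "\<delta> \<le> d4" "\<delta> \<le> d5" "\<delta> \<le> d6" "\<delta> \<le> d7" "\<delta> \<le> d8" "\<delta> \<le> d9"
    unfolding \<delta>_def by (intro Min_le; simp)+
  define \<pi> where "\<pi> = closest_point M"
  have pi_in: "\<pi> X \<in> M" and pi_min: "\<forall>p\<in>M. dist X (\<pi> X) \<le> dist X p" for X
    using closest_point_minimal[OF closedM AM] by (auto simp: \<pi>_def)
  have pi_near: "\<pi> X \<in> ball A (2 * \<rho>)" if "X \<in> ball A \<rho>" for X \<rho>
    using dist_closest_less[OF AM pi_min, of X \<rho>] that by simp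

  \<comment> \<open>One projection step\<close>
  have step: "norm (Y - \<pi> Y) \<le> c3 * norm (X - \<pi> X) \<and> norm (\<pi> Y - \<pi> X) \<le> 7 * e * norm (X - \<pi> X)"
    if X: "X \<in> ball A (\<delta> / 4)" and cases: "X \<in> M1 \<and> Y = closest_point M2 X \<or> X \<in> M2 \<and> Y = closest_point M1 X"
    for X Y
  proof -
    \<comment> \<open>With \<open>X\<close> within \<open>\<delta> / 4\<close> of \<open>A\<close>,
      both \<open>\<pi> X\<close> and \<open>Y\<close> stay within \<open>\<delta> / 2\<close>,
      where the estimates hold.\<close>
    have X': "X \<in> ball A \<delta>" using X \<open>0 < \<delta>\<close> by auto
    have p: "\<pi> X \<in> ball A \<delta>" using pi_near[OF X] \<open>0 < \<delta>\<close> by auto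
    have "dist A Y < 2 * (\<delta> / 4)"
      using cases
    proof (elim disjE conjE)
      assume "Y = closest_point M1 X"
      then show ?thesis
        using dist_closest_less[OF X1.A_in, of X Y "\<delta> / 4"] closest_point_minimal(2)[OF assms(1) X1.A_in] X by simp
    next
      assume "Y = closest_point M2 X"
      then show ?thesis
        using dist_closest_less[OF X2.A_in, of X Y "\<delta> / 4"] closest_point_minimal(2)[OF assms(2) X2.A_in] X by simp
    qed
    then have Y': "Y \<in> ball A \<delta>" using \<open>0 < \<delta>\<close> by simp
    have n: "norm (P (X - \<pi> X)) \<le> e * norm (X - \<pi> X)"
      using X' le pi_in pi_min by (intro d6(2)) auto
    have q: "norm (\<pi> Y - \<pi> X - P (Y - \<pi> X)) \<le> 3 * e * norm (Y - \<pi> X)"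
      unfolding \<pi>_def[THEN fun_cong, of Y] using Y' p le pi_in by (intro d3(2)) auto
    have in12: "\<pi> X \<in> M1" "\<pi> X \<in> M2" using pi_in[of X] by (auto simp: M_def)
    have "norm (Y - \<pi> X) \<le> (c2 + 5 * e) * norm (X - \<pi> X) \<and>
        norm (\<pi> Y - \<pi> X) \<le> 3 * e * norm (Y - \<pi> X) + 4 * e * norm (X - \<pi> X)"
      using cases
    proof (elim disjE conjE)
      assume "X \<in> M1" "Y = closest_point M2 X"
      have sec: "norm ((X - \<pi> X) - P1 (X - \<pi> X)) \<le> e * norm (X - \<pi> X)"
        using \<open>X \<in> M1\<close> X' p le in12 by (intro d4(2)) auto
      have app: "norm (Y - \<pi> X - P2 (X - \<pi> X)) \<le> 3 * e * norm (X - \<pi> X)"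
        unfolding \<open>Y = _\<close> using X' p le in12 by (intro d2(2)) auto
      note * = X1.orth_projector_axioms X2.orth_projector_axioms TT angle c2 n sec app q
      show ?thesis
        using alternating_step[OF X.orth_projector_axioms *] by blast
    next
      assume "X \<in> M2" "Y = closest_point M1 X"
      have sec: "norm ((X - \<pi> X) - P2 (X - \<pi> X)) \<le> e * norm (X - \<pi> X)"
        using \<open>X \<in> M2\<close> X' p le in12 by (intro d5(2)) auto
      have app: "norm (Y - \<pi> X - P1 (X - \<pi> X)) \<le> 3 * e * norm (X - \<pi> X)"
        unfolding \<open>Y = _\<close> using X' p le in12 by (intro d1(2)) auto
      note * = X2.orth_projector_axioms X1.orth_projector_axioms TT(2,1) angle' c2 n sec app q
      show ?thesis
        using alternating_step[OF X.orth_projector_axioms *] by blast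
    qed
    moreover have "(c2 + 5 * e) * norm (X - \<pi> X) \<le> c3 * norm (X - \<pi> X)"
      using e(3) by (intro mult_right_mono) auto
    ultimately have Yp: "norm (Y - \<pi> X) \<le> c3 * norm (X - \<pi> X)"
      and qp: "norm (\<pi> Y - \<pi> X) \<le> 3 * e * norm (Y - \<pi> X) + 4 * e * norm (X - \<pi> X)" by auto
    have "c3 * norm (X - \<pi> X) \<le> 1 * norm (X - \<pi> X)"
      using cs by (intro mult_right_mono) auto
    then have "3 * e * norm (Y - \<pi> X) \<le> 3 * e * norm (X - \<pi> X)"
      using Yp e by (intro mult_left_mono) auto
    then have "norm (\<pi> Y - \<pi> X) \<le> 7 * e * norm (X - \<pi> X)"
      using qp by simp
    moreover have "norm (Y - \<pi> Y) \<le> norm (Y - \<pi> X)"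
      using pi_min[of Y] pi_in[of X] by (simp add: dist_norm)
    ultimately show ?thesis using Yp by simp
  qed

  \<comment> \<open>The sequence started at \<open>B\<close>\<close>
  show ?thesis
    unfolding M_def[symmetric]
  proof (intro exI[of _ "\<delta> / 20"] conjI allI impI)
    \<comment> \<open>Five times this radius is the radius \<open>\<delta> / 4\<close> of the step
      estimate.\<close>
    show "0 < \<delta> / 20" using \<open>0 < \<delta>\<close> by simp
    fix B assume B: "norm (B - A) < \<delta> / 20"
    define b where "b = alt_proj M1 M2 B"
    have B': "B \<in> ball A (\<delta> / 20)" using B by (simp add: dist_norm norm_minus_commute)
    then have B\<delta>: "B \<in> ball A \<delta>" using \<open>0 < \<delta>\<close> by auto
    show "proj_defined M B" "proj_defined M1 B"
      using B\<delta> le by (auto intro!: d7 d9)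
    have b_in: "b k \<in> (if even k then M1 else M2)" for k
      using closest_point_minimal(1)[OF assms(1) X1.A_in] closest_point_minimal(1)[OF assms(2) X2.A_in]
      by (cases k) (auto simp: b_def)
    have b_Suc: "b k \<in> M1 \<and> b (Suc k) = closest_point M2 (b k) \<or> b k \<in> M2 \<and> b (Suc k) = closest_point M1 (b k)" for k
      using b_in[of k] by (auto simp: b_def split: if_splits)
    define d where "d = norm (B - \<pi> B)"
    have p0: "\<pi> B \<in> ball A \<delta>" using pi_near[OF B'] \<open>0 < \<delta>\<close> by auto
    have in12: "\<pi> B \<in> M1" "\<pi> B \<in> M2" using pi_in[of B] by (auto simp: M_def)
    have d_le: "norm (B - \<pi> B) \<le> norm (B - A)"
      using pi_min[of B] AM by (simp add: dist_norm)
    \<comment> \<open>In general \<open>B\<close> lies in neither set, so the first projection need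
      not contract; it costs a factor \<open>1 + 3 * e\<close> and a drift of
      \<open>10 * e\<close>.\<close>
    have i0: "norm (b 0 - \<pi> B - P1 (B - \<pi> B)) \<le> 3 * e * d"
      unfolding b_def alt_proj.simps d_def using B\<delta> p0 le in12 by (intro d1(2)) auto
    have i1: "norm (b 0 - \<pi> B) \<le> (1 + 3 * e) * d"
      using norm_triangle_ineq[of "b 0 - \<pi> B - P1 (B - \<pi> B)" "P1 (B - \<pi> B)"] i0
        X1.norm_P_le[of "B - \<pi> B"] by (simp add: d_def algebra_simps)
    have i2: "norm (b 0 - \<pi> (b 0)) \<le> (1 + 3 * e) * d"
      using pi_min[of "b 0"] pi_in[of B] i1 by (fastforce simp: dist_norm)
    have "norm (b 0 - A) < \<delta>"
    proof -
      have "dist A (b 0) < 2 * (\<delta> / 20)"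
        using dist_closest_less[OF X1.A_in, of B "b 0" "\<delta> / 20"] closest_point_minimal(2)[OF assms(1) X1.A_in] B'
        by (simp add: b_def)
      then show ?thesis using \<open>0 < \<delta>\<close> by (simp add: dist_norm norm_minus_commute)
    qed
    then have i3: "norm (\<pi> (b 0) - \<pi> B - P (b 0 - \<pi> B)) \<le> 3 * e * norm (b 0 - \<pi> B)"
      unfolding \<pi>_def[THEN fun_cong, of "b 0"] using p0 le pi_in
      by (intro d3(2)) (auto simp: dist_norm norm_minus_commute)
    have i4: "norm (P (b 0 - \<pi> B)) \<le> 4 * e * d"
    proof -
      \<comment> \<open>Projecting onto \<open>T1\<close> leaves the component along
        \<open>T\<close> unchanged, so \<open>P (b 0 - \<pi> B)\<close> is close to the small vector
        \<open>P (B - \<pi> B)\<close>.\<close>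
      have "(B - \<pi> B - P1 (B - \<pi> B)) \<bullet> t = 0" if "t \<in> T" for t
        using X1.residual_orth TT that by blast
      then have "P (B - \<pi> B - P1 (B - \<pi> B)) = 0"
        by (intro X.P_eqI) (auto simp: X.subspace_T subspace_0)
      then have "P (b 0 - \<pi> B) = P (b 0 - \<pi> B - P1 (B - \<pi> B)) + P (B - \<pi> B)"
        by (simp add: X.P_diff)
      moreover have "norm (P (b 0 - \<pi> B - P1 (B - \<pi> B))) \<le> 3 * e * d"
        using X.norm_P_le i0 order_trans by blast
      moreover have "norm (P (B - \<pi> B)) \<le> e * d"
        unfolding d_def using B\<delta> le pi_in pi_min by (intro d6(2)) auto
      ultimately show ?thesis
        using norm_triangle_ineq[of "P (b 0 - \<pi> B - P1 (B - \<pi> B))" "P (B - \<pi> B)"] by simp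
    qed
    have i5: "norm (\<pi> (b 0) - \<pi> B) \<le> 10 * e * d"
    proof -
      have "3 * e * norm (b 0 - \<pi> B) \<le> 3 * e * (2 * d)"
      proof (intro mult_left_mono)
        have "(1 + 3 * e) * d \<le> 2 * d" using e by (intro mult_right_mono) (auto simp: d_def)
        then show "norm (b 0 - \<pi> B) \<le> 2 * d" using i1 by simp
      qed (use e in auto)
      then have "norm (\<pi> (b 0) - \<pi> B - P (b 0 - \<pi> B)) \<le> 6 * e * d"
        using i3 by (simp add: mult_ac)
      then show ?thesis
        using i4 norm_triangle_ineq[of "\<pi> (b 0) - \<pi> B - P (b 0 - \<pi> B)" "P (b 0 - \<pi> B)"] by simp
    qed
    have st: "\<forall>k. norm (b k - A) < 5 * (\<delta> / 20) \<longrightarrow>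
      norm (b (Suc k) - \<pi> (b (Suc k))) \<le> c3 * norm (b k - \<pi> (b k)) \<and>
      norm (\<pi> (b (Suc k)) - \<pi> (b k)) \<le> 7 * e * norm (b k - \<pi> (b k))"
      using step b_Suc by (simp add: dist_norm norm_minus_commute)
    have c3: "0 \<le> c3" using cs by simp
    obtain l where l: "(\<lambda>k. \<pi> (b k)) \<longlonglongrightarrow> l" "b \<longlonglongrightarrow> l" "\<And>k. norm (b k - A) < 5 * (\<delta> / 20)"
      "norm (l - \<pi> B) \<le> 24 * e / (1 - c3) * d"
      "\<And>k. norm (l - b k) \<le> (1 + 17 * e / (1 - c3)) * c3 ^ k * d"
      unfolding d_def
      by (rule alternating_sequence_converges[where b = b and p = "\<lambda>k. \<pi> (b k)",
            OF e(1,2,5) c3 cs(6) d_le B i2[unfolded d_def] i5[unfolded d_def] st]) blast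
    show "proj_defined (if even k then M2 else M1) (alt_proj M1 M2 B k)" for k
    proof -
      have "b k \<in> ball A \<delta>"
        using l(3)[of k] \<open>0 < \<delta>\<close> by (simp add: dist_norm norm_minus_commute)
      then show ?thesis
        using le d7 d8 by (auto simp: b_def[symmetric])
    qed
    show "\<exists>Binf\<in>M. alt_proj M1 M2 B \<longlonglongrightarrow> Binf \<and>
      (B \<in> M \<longrightarrow> Binf = B \<and> (\<forall>k. alt_proj M1 M2 B k = B)) \<and>
      (B \<notin> M \<longrightarrow>
        norm (Binf - closest_point M B) < \<epsilon> * norm (B - closest_point M B) \<and>
        norm (Binf - alt_proj M1 M2 B 0) < (1 + \<epsilon>) * norm (B - closest_point M B) \<and>
        (\<forall>k\<ge>1. norm (Binf - alt_proj M1 M2 B k) < c ^ k * norm (B - closest_point M B)))"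
      unfolding b_def[symmetric] \<pi>_def[symmetric] d_def[symmetric]
    proof (intro bexI[of _ l] conjI impI allI)
      show "b \<longlonglongrightarrow> l" by fact
      show "l \<in> M"
        using closedM l(1) pi_in by (meson closed_sequentially)
      have bB: "b k = B" if "B \<in> M" for k
        using that by (induction k) (auto simp: b_def M_def closest_point_self)
      then show "b k = B" if "B \<in> M" for k using that by blast
      show "l = B" if "B \<in> M"
      proof -
        have "b = (\<lambda>k. B)" using bB[OF that] by (rule ext)
        then show ?thesis using l(2) by (simp add: LIMSEQ_const_iff)
      qed
    next
      assume "B \<notin> M"
      then have d: "0 < d" using pi_in[of B] by (auto simp: d_def)
      have "24 * e < \<epsilon> * (1 - c3)" using e by linarith
      then have "24 * e / (1 - c3) < \<epsilon>" using cs by (simp add: pos_divide_less_eq)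
      then have "24 * e / (1 - c3) * d < \<epsilon> * d"
        using d by (rule mult_strict_right_mono)
      then show "norm (l - \<pi> B) < \<epsilon> * d" using l(4) by simp
      have "17 * e < \<epsilon> * (1 - c3)" using e by linarith
      then have "17 * e / (1 - c3) < \<epsilon>" using cs by (simp add: pos_divide_less_eq)
      then have "(1 + 17 * e / (1 - c3)) * d < (1 + \<epsilon>) * d"
        using d by (intro mult_strict_right_mono) auto
      then show "norm (l - b 0) < (1 + \<epsilon>) * d" using l(5)[of 0] by simp
      fix k :: nat assume k: "1 \<le> k"
      then obtain n where n: "k = Suc n" by (cases k) auto
      \<comment> \<open>One of the \<open>k\<close> factors \<open>c3\<close> is spent to absorb the
        constant \<open>1 + 17 * e / (1 - c3)\<close> into \<open>c\<close>; this requires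
        \<open>k \<ge> 1\<close>.\<close>
      have "17 * e < (c - c3) * (1 - c3)" using e by linarith
      then have "17 * e / (1 - c3) < c - c3" using cs by (simp add: pos_divide_less_eq)
      moreover have "c3 * (17 * e / (1 - c3)) \<le> 1 * (17 * e / (1 - c3))"
        using cs e by (intro mult_right_mono) auto
      ultimately have c: "(1 + 17 * e / (1 - c3)) * c3 < c" by (simp add: algebra_simps)
      have "(1 + 17 * e / (1 - c3)) * c3 ^ k = ((1 + 17 * e / (1 - c3)) * c3) * c3 ^ n"
        by (simp add: n)
      also have "\<dots> < c * c3 ^ n"
        using c cs by (intro mult_strict_right_mono) auto
      also have "\<dots> \<le> c * c ^ n"
        using cs by (intro mult_left_mono power_mono) auto
      finally have "(1 + 17 * e / (1 - c3)) * c3 ^ k < c ^ k"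
        by (simp add: n)
      then have "(1 + 17 * e / (1 - c3)) * c3 ^ k * d < c ^ k * d"
        using d by (rule mult_strict_right_mono)
      then show "norm (l - b k) < c ^ k * d" using l(5)[of k] by simp
    qed
  qed
qed

end
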